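(* Let $\mathsf{D}$ be a coherent, interface-respecting DP-core with identity cleaning, equipped with a witness action, and let $k\in\mathbb{N}$. Then there exists a canonized $(k,\mathsf{D})$-refutation (for some sequence of relabeling functions) if and only if some graph of treewidth at most $k$ does not belong to the graph property $\mathcal{P}(\mathsf{D})$.
   Context: Graphs. A graph is a triple $G=(V,E,\rho)$ with $V,E$ finite subsets of $\mathbb{N}$ (vertices and edges, treated as distinct sorts) and $\rho\subseteq E\times V$ such that each edge is incident to exactly two distinct vertices (no loops; parallel edges allowed). A graph property is a set of graphs closed under isomorphism. Instructive decompositions. For $k\in\mathbb{N}$ the $k$-instructive alphabet consists of $\mathtt{Leaf}$ (arity 0), $\mathtt{IntroVertex}_u$, $\mathtt{ForgetVertex}_u$ ($u\in[k+1]$) and $\mathtt{IntroEdge}_{u,v}$ (distinct $u,v\in[k+1]$), all of arity 1, and $\mathtt{Join}$ (arity 2). A $k$-instructive tree decomposition is a term $\tau$ over this alphabet that is legal with respect to bags: $\mathtt{Leaf}$ has bag $\emptyset$; $\mathtt{IntroVertex}_u(\sigma)$ requires $u\notin$ bag$(\sigma)$ and has bag bag$(\sigma)\cup\{u\}$; $\mathtt{ForgetVertex}_u(\sigma)$ requires $u\in$ bag$(\sigma)$ and has bag bag$(\sigma)\setminus\{u\}$; $\mathtt{IntroEdge}_{u,v}(\sigma)$ requires $u,v\in$ bag$(\sigma)$ and keeps the bag; $\mathtt{Join}(\sigma_1,\sigma_2)$ requires equal bags and keeps it. $\mathcal{T}_k$ denotes the set of such terms. Each $\tau\in\mathcal{T}_k$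 defines a graph $G(\tau)$, its top bag $B(\tau)$ and an injective map $\theta_\tau:B(\tau)\to V(G(\tau))$: $\mathtt{Leaf}$ gives the empty graph; $\mathtt{IntroVertex}_u$ adds a fresh isolated vertex labeled $u$; $\mathtt{ForgetVertex}_u$ keeps the graph and removes label $u$; $\mathtt{IntroEdge}_{u,v}$ adds a new edge between the vertices labeled $u$ and $v$; $\mathtt{Join}$ takes the disjoint union of the two child graphs and identifies, for each label $u$ of the common bag, the two vertices labeled $u$ (edges are never identified). A graph has treewidth at most $k$ iff it is isomorphic to $G(\tau)$ for some $\tau\in\mathcal{T}_k$. DP-cores. A DP-core $\mathsf{D}$ is a family, indexed by $k\in\mathbb{N}$, of tuples $\mathsf{D}[k]$ consisting of: a decidable set $\mathcal{W}_k\subseteq\{0,1\}^*$ of local witnesses; a function $\mathtt{Final}_k:\mathcal{W}_k\to\{0,1\}$; a finite set $\mathtt{Leaf}_k\subseteq\mathcal{W}_k$; functions $\mathtt{IntroVertex}_u,\mathtt{ForgetVertex}_u,\mathtt{IntroEdge}_{u,v}$ from $\mathcal{W}_k$ to finite subsets of $\mathcal{W}_k$ and $\mathtt{Join}:\mathcal{W}_k\times\mathcal{W}_k\to$ finite subsets; and a cleaning function $\mathtt{Clean}_k$ on finite subsets. Transitions are lifted to finite witness sets by union ($\mathtt{Join}(S,S')=\bigcup_{w\in S,w'\in S'}\mathtt{Join}(w,w')$). The dynamization $\mathrm{Dyn}_k(\tau)$ is defined recursively: $\mathrm{Dyn}_k(\mathtt{Leaf})=\mathtt{Leaf}_k$ and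 for each other constructor apply the lifted transition to the children's dynamizations and then $\mathtt{Clean}_k$. $\mathsf{D}[k]$ accepts $\tau$ if $\mathrm{Dyn}_k(\tau)$ contains a witness $w$ with $\mathtt{Final}_k(w)=1$ (a final witness). $\mathcal{P}(\mathsf{D})=\bigcup_k\mathcal{P}(\mathsf{D}[k])$ where $\mathcal{P}(\mathsf{D}[k])$ is the isomorphism closure of $\{G(\tau):\tau\in\mathcal{T}_k\text{ accepted by }\mathsf{D}[k]\}$. $\mathsf{D}$ has identity cleaning if every $\mathtt{Clean}_k$ is the identity. $\mathsf{D}$ is coherent if for all $k,k'$, $\tau\in\mathcal{T}_k$, $\tau'\in\mathcal{T}_{k'}$ with $G(\tau)\cong G(\tau')$: $\mathsf{D}[k]$ accepts $\tau$ iff $\mathsf{D}[k']$ accepts $\tau'$. Labels and interface-respecting cores. Each witness $w\in\mathcal{W}_k$ has a set $\mathrm{Lbl}_k(w)\subseteq[k+1]$ of labels it mentions; $\mathrm{Lbl}_k(S)=\bigcup_{w\in S}\mathrm{Lbl}_k(w)$. A $(k,\mathsf{D})$-state is a pair $(b,S)$ with $b\subseteq[k+1]$ and $S$ a finite subset of $\mathcal{W}_k$; it is well-formed if $\mathrm{Lbl}_k(S)\subseteq b$, inconsistent if $S$ contains no final witness; the initial state is $(\emptyset,\mathtt{Leaf}_k)$. $\mathsf{D}$ is interface-respecting if for every $k$: $\mathrm{Lbl}_k(\mathtt{Leaf}_k)=\emptyset$, and for all $b\subseteq[k+1]$ and finite $S,S'$ with $\mathrm{Lbl}_k(S),\mathrm{Lbl}_k(S')\subseteq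 b$: $\mathrm{Lbl}_k(\mathtt{IntroVertex}_u(S))\subseteq b\cup\{u\}$ if $u\notin b$; $\mathrm{Lbl}_k(\mathtt{ForgetVertex}_u(S))\subseteq b\setminus\{u\}$ if $u\in b$; $\mathrm{Lbl}_k(\mathtt{IntroEdge}_{u,v}(S))\subseteq b$ if $u,v\in b$; $\mathrm{Lbl}_k(\mathtt{Join}(S,S'))\subseteq b$; $\mathrm{Lbl}_k(\mathtt{Clean}_k(S))\subseteq b$. Relabelings and witness actions. $\mathcal{F}_k$ is the set of injective functions $f:b\to[k+1]$ with $b\subseteq[k+1]$; $f^{-1}$ is the inverse on the image; $f\circ g$ is the partial composition with domain $\{u\in\mathrm{dom}(g):g(u)\in\mathrm{dom}(f)\}$. A witness action for $\mathsf{D}[k]$ is a partial function $\rho(f,w)\in\mathcal{W}_k$ defined exactly when $\mathrm{Lbl}_k(w)\subseteq\mathrm{dom}(f)$, extended pointwise to finite sets, such that whenever the expressions are defined: $\mathtt{Final}_k(\rho(f,w))=\mathtt{Final}_k(w)$; $\mathrm{Lbl}_k(\rho(f,w))=f(\mathrm{Lbl}_k(w))$; $\rho(f^{-1},\rho(f,w))=w$; $\rho(f\circ f',w)=\rho(f,\rho(f',w))$; $\rho(f',w)=\rho(f,w)$ whenever $f'$ extends $f$; and $\rho(f,\mathtt{IntroVertex}_u(w))=\mathtt{IntroVertex}_{f(u)}(\rho(f,w))$, $\rho(f,\mathtt{ForgetVertex}_u(w))=\mathtt{ForgetVertex}_{f(u)}(\rho(f,w))$ for $u\in\mathrm{dom}(f)$,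 $\rho(f,\mathtt{IntroEdge}_{u,v}(w))=\mathtt{IntroEdge}_{f(u),f(v)}(\rho(f,w))$ for distinct $u,v\in\mathrm{dom}(f)$, and $\rho(f,\mathtt{Join}(w,w'))=\mathtt{Join}(\rho(f,w),\rho(f,w'))$ when $\mathrm{Lbl}_k(w')\subseteq\mathrm{dom}(f)$. "$\mathsf{D}$ equipped with a witness action" means a witness action $\rho^k$ for $\mathsf{D}[k]$ is fixed for each $k$. Relabeled and canonized refutations. For a sequence $F=(f_1,\dots,f_m)$ in $\mathcal{F}_k$, an $F$-relabeled $(k,\mathsf{D})$-refutation is a sequence of states $(b_0,S_0),\dots,(b_m,S_m)$ such that $(b_0,S_0)$ is the initial state, $(b_m,S_m)$ is inconsistent, every state is well-formed, and for each $i\in[m]$ there is $j<i$ such that $(b_i,S_i)$ equals one of: $(f_i(b_j\cup\{u\}),\rho(f_i,\mathtt{IntroVertex}_u(S_j)))$ with $u\notin b_j$; $(f_i(b_j\setminus\{u\}),\rho(f_i,\mathtt{ForgetVertex}_u(S_j)))$ with $u\in b_j$; $(f_i(b_j),\rho(f_i,\mathtt{IntroEdge}_{u,v}(S_j)))$ with distinct $u,v\in b_j$; $(f_i(b_j),\rho(f_i,\mathtt{Join}(S_j,\rho(\pi,S_l))))$ with $l<i$, $b_l=b_j$ and $\pi$ a permutation of $b_j$; in each case $\mathrm{dom}(f_i)$ equals the displayed bag to which $f_i$ is applied. Fix a total order on $\mathcal{W}_k$; for a finite subset $X$ of an ordered set let $\mathrm{vec}(X)$ be its increasing enumeration, and order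 pairs $(b,S)$ by the lexicographic order of $(\mathrm{vec}(b),\mathrm{vec}(S))$ (a proper prefix is smaller). For a well-formed $(b,S)$, $\mathrm{CAN}(b,S)=\min\{(f(b),\rho(f,S)):f\in\mathcal{F}_k,\ \mathrm{dom}(f)=b\}$; $(b,S)$ is canonical if $\mathrm{CAN}(b,S)=(b,S)$. A canonized $(k,\mathsf{D})$-refutation is an $F$-relabeled $(k,\mathsf{D})$-refutation (for some $F$) all of whose states are canonical. *)

theory Defs
  imports Main
begin

text \<open>Multigraphs without loops. Vertices and edges are both natural numbers, but they are never
  compared with each other.\<close>

record mgraph =
  verts :: "nat set"
  edges :: "nat set"
  inc :: "(nat \<times> nat) set"

definition graph :: "mgraph \<Rightarrow> bool" where
  "graph G \<longleftrightarrow> finite (verts G) \<and> finite (edges G) \<and> inc G \<subseteq> edges G \<times> verts G \<and>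
     (\<forall>e\<in>edges G. card {v. (e, v) \<in> inc G} = 2)"

definition iso :: "mgraph \<Rightarrow> mgraph \<Rightarrow> bool" where
  "iso G H \<longleftrightarrow> (\<exists>f g. bij_betw f (verts G) (verts H) \<and> bij_betw g (edges G) (edges H) \<and>
     (\<forall>e\<in>edges G. \<forall>v\<in>verts G. (e, v) \<in> inc G \<longleftrightarrow> (g e, f v) \<in> inc H))"


abbreviation labels :: "nat \<Rightarrow> nat set" where
  "labels k \<equiv> {1..k + 1}"

datatype iterm =
    Leaf
  | IntroVertex nat iterm
  | ForgetVertex nat iterm
  | IntroEdge nat nat iterm
  | Join iterm iterm

primrec bag :: "iterm \<Rightarrow> nat set" where
  "bag Leaf = {}"
| "bag (IntroVertex u \<sigma>) = insert u (bag \<sigma>)"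
| "bag (ForgetVertex u \<sigma>) = bag \<sigma> - {u}"
| "bag (IntroEdge u v \<sigma>) = bag \<sigma>"
| "bag (Join \<sigma>\<^sub>1 \<sigma>\<^sub>2) = bag \<sigma>\<^sub>1"

text \<open>Terms over the \<open>k\<close>-instructive alphabet that are legal with respect to bags.\<close>

primrec itd :: "nat \<Rightarrow> iterm \<Rightarrow> bool" where
  "itd k Leaf \<longleftrightarrow> True"
| "itd k (IntroVertex u \<sigma>) \<longleftrightarrow> itd k \<sigma> \<and> u \<in> labels k \<and> u \<notin> bag \<sigma>"
| "itd k (ForgetVertex u \<sigma>) \<longleftrightarrow> itd k \<sigma> \<and> u \<in> labels k \<and> u \<in> bag \<sigma>"
| "itd k (IntroEdge u v \<sigma>) \<longleftrightarrow> itd k \<sigma> \<and> u \<in> labels k \<and> v \<in> labels k \<and> u \<noteq> v \<and>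
     u \<in> bag \<sigma> \<and> v \<in> bag \<sigma>"
| "itd k (Join \<sigma>\<^sub>1 \<sigma>\<^sub>2) \<longleftrightarrow> itd k \<sigma>\<^sub>1 \<and> itd k \<sigma>\<^sub>2 \<and> bag \<sigma>\<^sub>1 = bag \<sigma>\<^sub>2"

text \<open>The graph of a term together with the map from its top bag to the vertices. New vertices and
  edges are taken above all existing ones; in a join the second graph is shifted above the first
  one, except that its vertices carrying a label are sent to the vertices of the first graph with
  the same label.\<close>

definition fresh :: "nat set \<Rightarrow> nat" where
  "fresh A = (if A = {} then 0 else Suc (Max A))"

definition glue :: "mgraph \<Rightarrow> (nat \<rightharpoonup> nat) \<Rightarrow> (nat \<rightharpoonup> nat) \<Rightarrow> nat \<Rightarrow> nat" where
  "glue G\<^sub>1 \<theta>\<^sub>1 \<theta>\<^sub>2 x =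
     (if x \<in> ran \<theta>\<^sub>2 then the (\<theta>\<^sub>1 (THE u. \<theta>\<^sub>2 u = Some x)) else fresh (verts G\<^sub>1) + x)"

primrec lgraph :: "iterm \<Rightarrow> mgraph \<times> (nat \<rightharpoonup> nat)" where
  "lgraph Leaf = (\<lparr>verts = {}, edges = {}, inc = {}\<rparr>, Map.empty)"
| "lgraph (IntroVertex u \<sigma>) =
     (let (G, \<theta>) = lgraph \<sigma>; x = fresh (verts G)
      in (G\<lparr>verts := insert x (verts G)\<rparr>, \<theta>(u \<mapsto> x)))"
| "lgraph (ForgetVertex u \<sigma>) = (let (G, \<theta>) = lgraph \<sigma> in (G, \<theta>(u := None)))"
| "lgraph (IntroEdge u v \<sigma>) =
     (let (G, \<theta>) = lgraph \<sigma>; e = fresh (edges G)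
      in (G\<lparr>edges := insert e (edges G),
            inc := inc G \<union> {(e, the (\<theta> u)), (e, the (\<theta> v))}\<rparr>, \<theta>))"
| "lgraph (Join \<sigma>\<^sub>1 \<sigma>\<^sub>2) =
     (let (G\<^sub>1, \<theta>\<^sub>1) = lgraph \<sigma>\<^sub>1; (G\<^sub>2, \<theta>\<^sub>2) = lgraph \<sigma>\<^sub>2;
          \<phi> = glue G\<^sub>1 \<theta>\<^sub>1 \<theta>\<^sub>2; \<psi> = (\<lambda>e. fresh (edges G\<^sub>1) + e)
      in (\<lparr>verts = verts G\<^sub>1 \<union> \<phi> ` verts G\<^sub>2,
           edges = edges G\<^sub>1 \<union> \<psi> ` edges G\<^sub>2,
           inc = inc G\<^sub>1 \<union> map_prod \<psi> \<phi> ` inc G\<^sub>2\<rparr>, \<theta>\<^sub>1))"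

definition graph_of :: "iterm \<Rightarrow> mgraph" where
  "graph_of \<tau> = fst (lgraph \<tau>)"

definition treewidth_at_most :: "nat \<Rightarrow> mgraph \<Rightarrow> bool" where
  "treewidth_at_most k G \<longleftrightarrow> (\<exists>\<tau>. itd k \<tau> \<and> iso G (graph_of \<tau>))"


text \<open>Decidability of sets of binary words, by one-tape Turing machines over the tape alphabet
  \<open>{blank, 0, 1}\<close> (blank is \<open>None\<close>). A configuration consists of state, tape and head position; the
  states are \<open>{..<n}\<close>, where \<open>0\<close> is rejecting, \<open>1\<close> is accepting (both halting) and \<open>2\<close> is initial.\<close>

definition tm_step ::
    "(nat \<Rightarrow> bool option \<Rightarrow> nat \<times> bool option \<times> int) \<Rightarrow>
     nat \<times> (int \<Rightarrow> bool option) \<times> int \<Rightarrow> nat \<times> (int \<Rightarrow> bool option) \<times> int" where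
  "tm_step \<delta> = (\<lambda>(q, t, h). if q < 2 then (q, t, h)
     else (case \<delta> q (t h) of (q', a, d) \<Rightarrow> (q', t(h := a), h + d)))"

definition tm_input :: "bool list \<Rightarrow> int \<Rightarrow> bool option" where
  "tm_input w i = (if 0 \<le> i \<and> i < int (length w) then Some (w ! nat i) else None)"

definition decidable :: "bool list set \<Rightarrow> bool" where
  "decidable W \<longleftrightarrow> (\<exists>n \<delta>. 2 < n \<and>
     (\<forall>q<n. \<forall>a. fst (\<delta> q a) < n \<and> snd (snd (\<delta> q a)) \<in> {-1, 0, 1}) \<and>
     (\<forall>w. \<exists>m. fst ((tm_step \<delta> ^^ m) (2, tm_input w, 0)) = (if w \<in> W then 1 else 0)))"


type_synonym witness = "bool list"

text \<open>The components of a single tuple \<open>D[k]\<close>; a DP-core is a function from \<open>nat\<close> to such tuples.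
  The components are only meaningful on elements and finite subsets of \<open>wit\<close>.\<close>

record dp_tuple =
  wit :: "witness set"
  final :: "witness \<Rightarrow> bool"
  leaf :: "witness set"
  intro_vertex :: "nat \<Rightarrow> witness \<Rightarrow> witness set"
  forget_vertex :: "nat \<Rightarrow> witness \<Rightarrow> witness set"
  intro_edge :: "nat \<Rightarrow> nat \<Rightarrow> witness \<Rightarrow> witness set"
  join :: "witness \<Rightarrow> witness \<Rightarrow> witness set"
  clean :: "witness set \<Rightarrow> witness set"

definition fin_subset :: "witness set \<Rightarrow> dp_tuple \<Rightarrow> bool" where
  "fin_subset S C \<longleftrightarrow> finite S \<and> S \<subseteq> wit C"

definition dp_core :: "(nat \<Rightarrow> dp_tuple) \<Rightarrow> bool" where
  "dp_core D \<longleftrightarrow> (\<forall>k.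
     decidable (wit (D k)) \<and>
     fin_subset (leaf (D k)) (D k) \<and>
     (\<forall>w\<in>wit (D k).
        (\<forall>u\<in>labels k. fin_subset (intro_vertex (D k) u w) (D k)) \<and>
        (\<forall>u\<in>labels k. fin_subset (forget_vertex (D k) u w) (D k)) \<and>
        (\<forall>u\<in>labels k. \<forall>v\<in>labels k. u \<noteq> v \<longrightarrow> fin_subset (intro_edge (D k) u v w) (D k)) \<and>
        (\<forall>w'\<in>wit (D k). fin_subset (join (D k) w w') (D k))) \<and>
     (\<forall>S. fin_subset S (D k) \<longrightarrow> fin_subset (clean (D k) S) (D k)))"

definition intro_vertex_set :: "dp_tuple \<Rightarrow> nat \<Rightarrow> witness set \<Rightarrow> witness set" where
  "intro_vertex_set C u S = (\<Union>w\<in>S. intro_vertex C u w)"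

definition forget_vertex_set :: "dp_tuple \<Rightarrow> nat \<Rightarrow> witness set \<Rightarrow> witness set" where
  "forget_vertex_set C u S = (\<Union>w\<in>S. forget_vertex C u w)"

definition intro_edge_set :: "dp_tuple \<Rightarrow> nat \<Rightarrow> nat \<Rightarrow> witness set \<Rightarrow> witness set" where
  "intro_edge_set C u v S = (\<Union>w\<in>S. intro_edge C u v w)"

definition join_set :: "dp_tuple \<Rightarrow> witness set \<Rightarrow> witness set \<Rightarrow> witness set" where
  "join_set C S S' = (\<Union>w\<in>S. \<Union>w'\<in>S'. join C w w')"

primrec dyn :: "dp_tuple \<Rightarrow> iterm \<Rightarrow> witness set" where
  "dyn C Leaf = leaf C"
| "dyn C (IntroVertex u \<sigma>) = clean C (intro_vertex_set C u (dyn C \<sigma>))"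
| "dyn C (ForgetVertex u \<sigma>) = clean C (forget_vertex_set C u (dyn C \<sigma>))"
| "dyn C (IntroEdge u v \<sigma>) = clean C (intro_edge_set C u v (dyn C \<sigma>))"
| "dyn C (Join \<sigma>\<^sub>1 \<sigma>\<^sub>2) = clean C (join_set C (dyn C \<sigma>\<^sub>1) (dyn C \<sigma>\<^sub>2))"

definition accepts :: "dp_tuple \<Rightarrow> iterm \<Rightarrow> bool" where
  "accepts C \<tau> \<longleftrightarrow> (\<exists>w\<in>dyn C \<tau>. final C w)"

definition level_property :: "nat \<Rightarrow> dp_tuple \<Rightarrow> mgraph set" where
  "level_property k C = {G. graph G \<and> (\<exists>\<tau>. itd k \<tau> \<and> accepts C \<tau> \<and> iso G (graph_of \<tau>))}"

definition core_property :: "(nat \<Rightarrow> dp_tuple) \<Rightarrow> mgraph set" where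
  "core_property D = (\<Union>k. level_property k (D k))"

definition identity_cleaning :: "(nat \<Rightarrow> dp_tuple) \<Rightarrow> bool" where
  "identity_cleaning D \<longleftrightarrow> (\<forall>k S. fin_subset S (D k) \<longrightarrow> clean (D k) S = S)"

definition coherent :: "(nat \<Rightarrow> dp_tuple) \<Rightarrow> bool" where
  "coherent D \<longleftrightarrow> (\<forall>k k' \<tau> \<tau>'. itd k \<tau> \<longrightarrow> itd k' \<tau>' \<longrightarrow> iso (graph_of \<tau>) (graph_of \<tau>') \<longrightarrow>
     (accepts (D k) \<tau> \<longleftrightarrow> accepts (D k') \<tau>'))"


definition label_assignment ::
    "(nat \<Rightarrow> dp_tuple) \<Rightarrow> (nat \<Rightarrow> witness \<Rightarrow> nat set) \<Rightarrow> bool" where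
  "label_assignment D Lbl \<longleftrightarrow> (\<forall>k. \<forall>w\<in>wit (D k). Lbl k w \<subseteq> labels k)"

definition Lbl_set :: "(witness \<Rightarrow> nat set) \<Rightarrow> witness set \<Rightarrow> nat set" where
  "Lbl_set L S = (\<Union>w\<in>S. L w)"

definition interface_respecting ::
    "(nat \<Rightarrow> dp_tuple) \<Rightarrow> (nat \<Rightarrow> witness \<Rightarrow> nat set) \<Rightarrow> bool" where
  "interface_respecting D Lbl \<longleftrightarrow> (\<forall>k.
     Lbl_set (Lbl k) (leaf (D k)) = {} \<and>
     (\<forall>b S S'. b \<subseteq> labels k \<longrightarrow> fin_subset S (D k) \<longrightarrow> fin_subset S' (D k) \<longrightarrow>
        Lbl_set (Lbl k) S \<subseteq> b \<longrightarrow> Lbl_set (Lbl k) S' \<subseteq> b \<longrightarrow>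
        (\<forall>u\<in>labels k. u \<notin> b \<longrightarrow> Lbl_set (Lbl k) (intro_vertex_set (D k) u S) \<subseteq> b \<union> {u}) \<and>
        (\<forall>u\<in>b. Lbl_set (Lbl k) (forget_vertex_set (D k) u S) \<subseteq> b - {u}) \<and>
        (\<forall>u\<in>b. \<forall>v\<in>b. u \<noteq> v \<longrightarrow> Lbl_set (Lbl k) (intro_edge_set (D k) u v S) \<subseteq> b) \<and>
        Lbl_set (Lbl k) (join_set (D k) S S') \<subseteq> b \<and>
        Lbl_set (Lbl k) (clean (D k) S) \<subseteq> b))"


text \<open>Partial injections of the label set into itself. Composition is \<^term>\<open>(\<circ>\<^sub>m)\<close> and extension is
  \<^term>\<open>(\<subseteq>\<^sub>m)\<close>.\<close>

definition relabelings :: "nat \<Rightarrow> (nat \<rightharpoonup> nat) set" where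
  "relabelings k = {f. dom f \<subseteq> labels k \<and> ran f \<subseteq> labels k \<and> inj_on f (dom f)}"

definition map_inverse :: "(nat \<rightharpoonup> nat) \<Rightarrow> (nat \<rightharpoonup> nat)" where
  "map_inverse f = (\<lambda>v. if v \<in> ran f then Some (THE u. f u = Some v) else None)"

definition map_image :: "(nat \<rightharpoonup> nat) \<Rightarrow> nat set \<Rightarrow> nat set" where
  "map_image f b = {v. \<exists>u\<in>b. f u = Some v}"

text \<open>A witness action is a partial function, hence option-valued; its pointwise extension to a set
  is defined only if it is defined on all elements.\<close>

type_synonym action = "(nat \<rightharpoonup> nat) \<Rightarrow> witness \<rightharpoonup> witness"

definition act_set :: "action \<Rightarrow> (nat \<rightharpoonup> nat) \<Rightarrow> witness set \<Rightarrow> witness set option" where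
  "act_set \<rho> f S = (if \<forall>w\<in>S. \<rho> f w \<noteq> None then Some ((\<lambda>w. the (\<rho> f w)) ` S) else None)"

definition witness_action ::
    "nat \<Rightarrow> dp_tuple \<Rightarrow> (witness \<Rightarrow> nat set) \<Rightarrow> action \<Rightarrow> bool" where
  "witness_action k C L \<rho> \<longleftrightarrow>
     (\<forall>f\<in>relabelings k. \<forall>w\<in>wit C.
        (\<rho> f w \<noteq> None \<longleftrightarrow> L w \<subseteq> dom f) \<and>
        (\<forall>x. \<rho> f w = Some x \<longrightarrow>
           x \<in> wit C \<and>
           final C x = final C w \<and>
           L x = map_image f (L w) \<and>
           \<rho> (map_inverse f) x = Some w)) \<and>
     (\<forall>f\<in>relabelings k. \<forall>f'\<in>relabelings k. \<forall>w\<in>wit C. \<forall>x y.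
        \<rho> f' w = Some x \<longrightarrow> \<rho> f x = Some y \<longrightarrow> \<rho> (f \<circ>\<^sub>m f') w = Some y) \<and>
     (\<forall>f\<in>relabelings k. \<forall>f'\<in>relabelings k. \<forall>w\<in>wit C. \<forall>x.
        f \<subseteq>\<^sub>m f' \<longrightarrow> \<rho> f w = Some x \<longrightarrow> \<rho> f' w = Some x) \<and>
     (\<forall>f\<in>relabelings k. \<forall>w\<in>wit C. \<forall>x T. \<rho> f w = Some x \<longrightarrow>
        (\<forall>u\<in>dom f. act_set \<rho> f (intro_vertex C u w) = Some T \<longrightarrow>
           T = intro_vertex C (the (f u)) x) \<and>
        (\<forall>u\<in>dom f. act_set \<rho> f (forget_vertex C u w) = Some T \<longrightarrow>
           T = forget_vertex C (the (f u)) x) \<and>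
        (\<forall>u\<in>dom f. \<forall>v\<in>dom f. u \<noteq> v \<longrightarrow> act_set \<rho> f (intro_edge C u v w) = Some T \<longrightarrow>
           T = intro_edge C (the (f u)) (the (f v)) x) \<and>
        (\<forall>w'\<in>wit C. \<forall>x'. \<rho> f w' = Some x' \<longrightarrow> act_set \<rho> f (join C w w') = Some T \<longrightarrow>
           T = join C x x'))"


type_synonym state = "nat set \<times> witness set"

definition is_state :: "nat \<Rightarrow> dp_tuple \<Rightarrow> state \<Rightarrow> bool" where
  "is_state k C = (\<lambda>(b, S). b \<subseteq> labels k \<and> fin_subset S C)"

definition well_formed :: "(witness \<Rightarrow> nat set) \<Rightarrow> state \<Rightarrow> bool" where
  "well_formed L = (\<lambda>(b, S). Lbl_set L S \<subseteq> b)"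

definition inconsistent :: "dp_tuple \<Rightarrow> state \<Rightarrow> bool" where
  "inconsistent C = (\<lambda>(b, S). \<not> (\<exists>w\<in>S. final C w))"

definition initial_state :: "dp_tuple \<Rightarrow> state" where
  "initial_state C = ({}, leaf C)"

definition relabels :: "action \<Rightarrow> (nat \<rightharpoonup> nat) \<Rightarrow> state \<Rightarrow> state \<Rightarrow> bool" where
  "relabels \<rho> f = (\<lambda>(b, S) (b', S'). dom f = b \<and> b' = map_image f b \<and> act_set \<rho> f S = Some S')"

text \<open>The list \<open>sts\<close> of states is indexed from 0, whereas the list \<open>F\<close> represents
  \<open>(f\<^sub>1, \<dots>, f\<^sub>m)\<close>, so that \<open>f\<^sub>i\<close> is \<open>F ! (i - 1)\<close>.\<close>

definition relabeled_refutation ::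
    "nat \<Rightarrow> dp_tuple \<Rightarrow> (witness \<Rightarrow> nat set) \<Rightarrow> action \<Rightarrow> (nat \<rightharpoonup> nat) list \<Rightarrow> state list \<Rightarrow> bool"
  where
  "relabeled_refutation k C L \<rho> F sts \<longleftrightarrow>
     set F \<subseteq> relabelings k \<and>
     length sts = length F + 1 \<and>
     (\<forall>s\<in>set sts. is_state k C s \<and> well_formed L s) \<and>
     sts ! 0 = initial_state C \<and>
     inconsistent C (sts ! length F) \<and>
     (\<forall>i\<in>{1..length F}. \<exists>j<i. \<exists>b S. sts ! j = (b, S) \<and>
        ((\<exists>u\<in>labels k. u \<notin> b \<and>
            relabels \<rho> (F ! (i - 1)) (b \<union> {u}, intro_vertex_set C u S) (sts ! i)) \<or>
         (\<exists>u\<in>b. relabels \<rho> (F ! (i - 1)) (b - {u}, forget_vertex_set C u S) (sts ! i)) \<or>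
         (\<exists>u\<in>b. \<exists>v\<in>b. u \<noteq> v \<and>
            relabels \<rho> (F ! (i - 1)) (b, intro_edge_set C u v S) (sts ! i)) \<or>
         (\<exists>l<i. \<exists>S' \<pi> T. sts ! l = (b, S') \<and>
            \<pi> \<in> relabelings k \<and> dom \<pi> = b \<and> ran \<pi> = b \<and> act_set \<rho> \<pi> S' = Some T \<and>
            relabels \<rho> (F ! (i - 1)) (b, join_set C S T) (sts ! i))))"

text \<open>The relation \<open>r\<close> is the (reflexive) total order fixed on the witnesses. Note that a proper
  prefix is smaller with respect to \<^term>\<open>lexord\<close>.\<close>

definition vec :: "witness rel \<Rightarrow> witness set \<Rightarrow> witness list" where
  "vec r X = (THE xs. set xs = X \<and> sorted_wrt (\<lambda>x y. (x, y) \<in> r - Id) xs)"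

definition state_less :: "witness rel \<Rightarrow> state rel" where
  "state_less r = inv_image (lexord less_than <*lex*> lexord (r - Id))
     (\<lambda>(b, S). (sorted_list_of_set b, vec r S))"

definition CAN :: "nat \<Rightarrow> action \<Rightarrow> witness rel \<Rightarrow> state \<Rightarrow> state" where
  "CAN k \<rho> r s =
     (let X = {s'. \<exists>f\<in>relabelings k. relabels \<rho> f s s'}
      in THE s'. s' \<in> X \<and> (\<forall>s''\<in>X. s'' = s' \<or> (s', s'') \<in> state_less r))"

definition canonical :: "nat \<Rightarrow> action \<Rightarrow> witness rel \<Rightarrow> state \<Rightarrow> bool" where
  "canonical k \<rho> r s \<longleftrightarrow> CAN k \<rho> r s = s"

definition canonized_refutation ::
    "nat \<Rightarrow> dp_tuple \<Rightarrow> (witness \<Rightarrow> nat set) \<Rightarrow> action \<Rightarrow> witness rel \<Rightarrow> state list \<Rightarrow> bool" where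
  "canonized_refutation k C L \<rho> r sts \<longleftrightarrow>
     (\<exists>F. relabeled_refutation k C L \<rho> F sts) \<and> (\<forall>s\<in>set sts. canonical k \<rho> r s)"

end

theory Submission
  imports Defs "HOL-Combinatorics.Permutations"
begin

text \<open>
  A relabeling of a bag extends to a permutation \<open>p\<close> of the whole label set, and applying \<open>p\<close> to
  every instruction of a term \<open>\<tau>\<close> yields a term whose bag and dynamization are the relabelings of those
  of \<open>\<tau>\<close>. Hence the states that occur in relabeled refutations are exactly the pairs of bag and
  dynamization of terms, and an inconsistent one comes from a term that is not accepted; by
  coherence its graph is outside the property.

  Conversely, walk through a rejected term bottom-up and replace the state of each subterm by the
  least state among its relabelings. For a join, the order on states compares bags first, so the two
  least states have the same bag, and they differ from a common relabeling of both children only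
  by a permutation of that bag.
\<close>

section \<open>Graphs of terms\<close>

text \<open>A relabeling of the top bag says nothing about labels that were introduced and forgotten
  further down, and the laws of a witness action hold only where the action is defined. Permutations
  of the full label set remove both obstacles: they apply to every instruction of a term and act on
  every witness. The laws of an action include none for the cleaning function; identity cleaning is
  what lets dynamizations commute with permutations. The minimum in \<open>CAN\<close> over
  relabelings of a state becomes a minimum over the finitely many permuted versions of a term.
  Rejection of one term does not by itself exclude its graph from the property, since another term,
  possibly at another level, might define an isomorphic graph and be accepted; coherence rules this
  out. It also has to be checked that terms define graphs, that is, that gluing leaves every edge
  with exactly two endpoints.\<close>

lemma less_fresh: "finite A \<Longrightarrow> x \<in> A \<Longrightarrow> x < fresh A"
  unfolding fresh_def using Max_ge[of A x] by (auto simp: less_Suc_eq_le)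

text \<open>Invariant for the recursion of \<open>lgraph\<close>. Injectivity of the label map keeps
  \<open>IntroEdge\<close> from producing a loop and makes the gluing in a join injective.\<close>

definition labelled_graph :: "mgraph \<Rightarrow> (nat \<rightharpoonup> nat) \<Rightarrow> bool" where
  "labelled_graph G \<theta> \<longleftrightarrow> graph G \<and> ran \<theta> \<subseteq> verts G \<and> inj_on \<theta> (dom \<theta>)"

lemma glue_labelled:
  assumes "inj_on \<theta>\<^sub>2 (dom \<theta>\<^sub>2)" "\<theta>\<^sub>2 u = Some x"
  shows "glue G \<theta>\<^sub>1 \<theta>\<^sub>2 x = the (\<theta>\<^sub>1 u)"
proof -
  have "(THE u. \<theta>\<^sub>2 u = Some x) = u"
    using assms by (intro the_equality) (auto simp: inj_on_def dom_def)
  then show ?thesis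
    using assms(2) by (auto simp: glue_def ran_def)
qed

text \<open>Labelled vertices of the second graph land on vertices of the first, below
  \<open>fresh (verts G\<^sub>1)\<close>, whereas unlabelled ones are shifted to or above that
  bound, so the two kinds never meet. Among labelled vertices, injectivity of the label maps on
  their common domain suffices.\<close>

lemma inj_glue:
  assumes "labelled_graph G\<^sub>1 \<theta>\<^sub>1" "labelled_graph G\<^sub>2 \<theta>\<^sub>2" "dom \<theta>\<^sub>1 = dom \<theta>\<^sub>2"
  shows "inj (glue G\<^sub>1 \<theta>\<^sub>1 \<theta>\<^sub>2)"
proof -
  let ?\<phi> = "glue G\<^sub>1 \<theta>\<^sub>1 \<theta>\<^sub>2"
  have fin: "finite (verts G\<^sub>1)" and ran: "ran \<theta>\<^sub>1 \<subseteq> verts G\<^sub>1"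
    and inj1: "inj_on \<theta>\<^sub>1 (dom \<theta>\<^sub>1)" and inj2: "inj_on \<theta>\<^sub>2 (dom \<theta>\<^sub>2)"
    using assms by (auto simp: labelled_graph_def graph_def)
  have lab: "\<exists>u y. \<theta>\<^sub>2 u = Some x \<and> \<theta>\<^sub>1 u = Some y \<and> ?\<phi> x = y \<and> y < fresh (verts G\<^sub>1)"
    if "x \<in> ran \<theta>\<^sub>2" for x
  proof -
    obtain u where u: "\<theta>\<^sub>2 u = Some x" using \<open>x \<in> ran \<theta>\<^sub>2\<close> by (auto simp: ran_def)
    then obtain y where y: "\<theta>\<^sub>1 u = Some y" using assms(3) by blast
    then have "y < fresh (verts G\<^sub>1)" using ran fin by (intro less_fresh) (auto simp: ran_def)
    then show ?thesis using u y glue_labelled[OF inj2 u] by auto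
  qed
  have unlab: "?\<phi> x = fresh (verts G\<^sub>1) + x" if "x \<notin> ran \<theta>\<^sub>2" for x
    using that by (simp add: glue_def)
  show ?thesis
  proof (rule injI)
    fix x x' assume eq: "?\<phi> x = ?\<phi> x'"
    show "x = x'"
    proof (cases "x \<in> ran \<theta>\<^sub>2"; cases "x' \<in> ran \<theta>\<^sub>2")
      assume "x \<in> ran \<theta>\<^sub>2" "x' \<in> ran \<theta>\<^sub>2"
      then obtain u y u' y' where "\<theta>\<^sub>2 u = Some x" "\<theta>\<^sub>1 u = Some y" "?\<phi> x = y"
        "\<theta>\<^sub>2 u' = Some x'" "\<theta>\<^sub>1 u' = Some y'" "?\<phi> x' = y'"
        using lab[of x] lab[of x'] by auto
      moreover from this have "u = u'"
        using inj1 eq by (auto simp: inj_on_def dom_def)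
      ultimately show "x = x'" by simp
    next
      assume "x \<in> ran \<theta>\<^sub>2" "x' \<notin> ran \<theta>\<^sub>2"
      then show "x = x'" using lab[of x] unlab[of x'] eq by auto
    next
      assume "x \<notin> ran \<theta>\<^sub>2" "x' \<in> ran \<theta>\<^sub>2"
      then show "x = x'" using lab[of x'] unlab[of x] eq by auto
    qed (use unlab eq in simp)
  qed
qed

lemma labelled_graph_lgraph:
  "itd k \<tau> \<Longrightarrow> lgraph \<tau> = (G, \<theta>) \<Longrightarrow> labelled_graph G \<theta> \<and> dom \<theta> = bag \<tau>"
proof (induction \<tau> arbitrary: G \<theta>)
  case Leaf
  then show ?case by (auto simp: labelled_graph_def graph_def)
next
  case (IntroVertex u \<sigma>)
  obtain H \<eta> where H: "lgraph \<sigma> = (H, \<eta>)" by (cases "lgraph \<sigma>")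
  let ?x = "fresh (verts H)"
  have IH: "labelled_graph H \<eta>" "dom \<eta> = bag \<sigma>" using IntroVertex H by auto
  have G: "G = H\<lparr>verts := insert ?x (verts H)\<rparr>" "\<theta> = \<eta>(u \<mapsto> ?x)"
    using IntroVertex.prems H by (auto simp: Let_def)
  have "u \<notin> dom \<eta>" using IntroVertex.prems IH by auto
  moreover have "?x \<notin> verts H"
    using IH(1) less_fresh[of "verts H" ?x] by (auto simp: labelled_graph_def graph_def)
  ultimately show ?case
    using IH G by (auto simp: labelled_graph_def graph_def inj_on_def ran_def dom_def)
next
  case (ForgetVertex u \<sigma>)
  obtain H \<eta> where H: "lgraph \<sigma> = (H, \<eta>)" by (cases "lgraph \<sigma>")
  have IH: "labelled_graph H \<eta>" "dom \<eta> = bag \<sigma>" using ForgetVertex H by auto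
  have G: "G = H" "\<theta> = \<eta>(u := None)"
    using ForgetVertex.prems H by (auto simp: Let_def)
  have "ran \<theta> \<subseteq> ran \<eta>" using G(2) by (auto simp: ran_def split: if_splits)
  moreover have "inj_on \<theta> (dom \<theta>)"
    using IH(1) G(2) by (simp add: labelled_graph_def inj_on_def)
  moreover have "dom \<theta> = bag \<sigma> - {u}" using G(2) IH(2) by simp
  ultimately show ?case using IH(1) G(1) by (auto simp: labelled_graph_def)
next
  case (IntroEdge u v \<sigma>)
  obtain H \<eta> where H: "lgraph \<sigma> = (H, \<eta>)" by (cases "lgraph \<sigma>")
  let ?e = "fresh (edges H)"
  have IH: "labelled_graph H \<eta>" "dom \<eta> = bag \<sigma>" using IntroEdge H by auto
  obtain x y where xy: "\<eta> u = Some x" "\<eta> v = Some y"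
    using IntroEdge.prems IH by fastforce
  have G: "G = H\<lparr>edges := insert ?e (edges H), inc := inc H \<union> {(?e, x), (?e, y)}\<rparr>" "\<theta> = \<eta>"
    using IntroEdge.prems H xy by (auto simp: Let_def)
  have "x \<noteq> y" using IH(1) xy IntroEdge.prems by (auto simp: labelled_graph_def inj_on_def dom_def)
  have "x \<in> verts H" "y \<in> verts H" using IH(1) xy by (auto simp: labelled_graph_def ran_def)
  have new: "?e \<notin> edges H"
    using IH(1) less_fresh[of "edges H" ?e] by (auto simp: labelled_graph_def graph_def)
  have "{z. (?e, z) \<in> inc G} = {x, y}"
    using G new IH(1) by (auto simp: labelled_graph_def graph_def)
  then have "card {z. (?e, z) \<in> inc G} = 2" using \<open>x \<noteq> y\<close> by simp
  moreover have "{z. (e, z) \<in> inc G} = {z. (e, z) \<in> inc H}" if "e \<in> edges H" for e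
    using that new G by auto
  ultimately show ?case
    using IH G \<open>x \<in> verts H\<close> \<open>y \<in> verts H\<close> by (auto simp: labelled_graph_def graph_def)
next
  case (Join \<sigma>\<^sub>1 \<sigma>\<^sub>2)
  obtain G\<^sub>1 \<theta>\<^sub>1 G\<^sub>2 \<theta>\<^sub>2 where H: "lgraph \<sigma>\<^sub>1 = (G\<^sub>1, \<theta>\<^sub>1)" "lgraph \<sigma>\<^sub>2 = (G\<^sub>2, \<theta>\<^sub>2)"
    by (cases "lgraph \<sigma>\<^sub>1"; cases "lgraph \<sigma>\<^sub>2")
  let ?\<phi> = "glue G\<^sub>1 \<theta>\<^sub>1 \<theta>\<^sub>2" and ?\<psi> = "\<lambda>e. fresh (edges G\<^sub>1) + e"
  have IH: "labelled_graph G\<^sub>1 \<theta>\<^sub>1" "dom \<theta>\<^sub>1 = bag \<sigma>\<^sub>1" "labelled_graph G\<^sub>2 \<theta>\<^sub>2" "dom \<theta>\<^sub>2 = bag \<sigma>\<^sub>2"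
    using Join H by auto
  have G: "G = \<lparr>verts = verts G\<^sub>1 \<union> ?\<phi> ` verts G\<^sub>2, edges = edges G\<^sub>1 \<union> ?\<psi> ` edges G\<^sub>2,
      inc = inc G\<^sub>1 \<union> map_prod ?\<psi> ?\<phi> ` inc G\<^sub>2\<rparr>" "\<theta> = \<theta>\<^sub>1"
    using Join.prems H by (auto simp: Let_def)
  have inj: "inj ?\<phi>" using IH Join.prems by (intro inj_glue) auto
  have gr: "graph G\<^sub>1" "graph G\<^sub>2" using IH by (auto simp: labelled_graph_def)
  \<comment> \<open>Shifted edges are new, so edges of the first graph keep their incidences.
    Incidences of a shifted edge are an image under the injective \<open>?\<phi>\<close>, which
    preserves the count of two endpoints.\<close>
  have disj: "?\<psi> e \<notin> edges G\<^sub>1" for e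
    using gr less_fresh[of "edges G\<^sub>1" "?\<psi> e"] by (auto simp: graph_def)
  have "{z. (e, z) \<in> inc G} = {z. (e, z) \<in> inc G\<^sub>1}" if "e \<in> edges G\<^sub>1" for e
    using that disj G by auto
  then have "card {z. (e, z) \<in> inc G} = 2" if "e \<in> edges G\<^sub>1" for e
    using that gr by (auto simp: graph_def)
  moreover have "{z. (?\<psi> e, z) \<in> inc G} = ?\<phi> ` {z. (e, z) \<in> inc G\<^sub>2}" if "e \<in> edges G\<^sub>2" for e
    using that disj G gr by (auto simp: graph_def)
  then have "card {z. (?\<psi> e, z) \<in> inc G} = 2" if "e \<in> edges G\<^sub>2" for e
    using that gr inj by (auto simp: graph_def card_image inj_on_subset)
  ultimately have "\<forall>e\<in>edges G. card {z. (e, z) \<in> inc G} = 2" using G by auto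
  moreover have "inc G \<subseteq> edges G \<times> verts G" using gr G by (auto simp: graph_def)
  ultimately have "graph G" using gr G by (auto simp: graph_def)
  then show ?case using G IH by (auto simp: labelled_graph_def)
qed

lemma graph_graph_of: "itd k \<tau> \<Longrightarrow> graph (graph_of \<tau>)"
  using labelled_graph_lgraph[of k \<tau>] unfolding graph_of_def labelled_graph_def
  by (cases "lgraph \<tau>") auto

lemma iso_refl: "iso G G"
  unfolding iso_def by (rule exI[of _ id], rule exI[of _ id]) auto

section \<open>The order on states\<close>

text \<open>Uniqueness for the description operator in \<open>vec\<close>: if the heads differed,
  each would lie in the tail of the other list, and \<open>R\<close> would relate them in both
  directions.\<close>

lemma sorted_wrt_unique:
  assumes "asym R" "sorted_wrt (\<lambda>x y. (x, y) \<in> R) xs" "sorted_wrt (\<lambda>x y. (x, y) \<in> R) ys"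
    "set xs = set ys"
  shows "xs = ys"
  using assms(2-)
proof (induction xs arbitrary: ys)
  case (Cons x xs)
  then obtain y ys' where ys: "ys = y # ys'" by (cases ys) auto
  have "x = y"
  proof (rule ccontr)
    assume "x \<noteq> y"
    then have "x \<in> set ys'" "y \<in> set xs" using Cons.prems(3) ys by auto
    then have "(y, x) \<in> R" "(x, y) \<in> R" using Cons.prems(1,2) ys by auto
    then show False using assms(1) by (meson asymD)
  qed
  moreover have "x \<notin> set xs" "y \<notin> set ys'"
    using Cons.prems(1,2) ys asymD[OF assms(1)] by auto
  ultimately have "set xs = set ys'" using Cons.prems(3) ys by auto
  then show ?case using Cons ys \<open>x = y\<close> by auto
qed simp

text \<open>Existence for the description operator in \<open>vec\<close>: a least element goes in
  front, and induction lists the rest.\<close>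

lemma sorted_wrt_exists:
  assumes "finite A" "total_on A R" "trans R"
  shows "\<exists>xs. set xs = A \<and> sorted_wrt (\<lambda>x y. (x, y) \<in> R) xs"
  using assms(1,2)
proof (induction A rule: finite_psubset_induct)
  case (psubset A)
  show ?case
  proof (cases "A = {}")
    case False
    have "\<exists>l\<in>A. \<forall>x\<in>A. x \<noteq> l \<longrightarrow> (l, x) \<in> R"
      using psubset.prems assms(3) psubset.hyps False
      by (intro Finite_Set.bex_least_element)
        (auto simp: transp_on_def totalp_on_def total_on_def dest: transD)
    then obtain l where l: "l \<in> A" "\<forall>x\<in>A. x \<noteq> l \<longrightarrow> (l, x) \<in> R" by blast
    have "total_on (A - {l}) R" using psubset.prems by (auto simp: total_on_def)
    then obtain xs where "set xs = A - {l}" "sorted_wrt (\<lambda>x y. (x, y) \<in> R) xs"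
      using psubset.IH[of "A - {l}"] l(1) by blast
    then have "set (l # xs) = A \<and> sorted_wrt (\<lambda>x y. (x, y) \<in> R) (l # xs)" using l by auto
    then show ?thesis by blast
  qed simp
qed

text \<open>Relative to lists over \<open>A\<close>, because the order fixed on the witnesses is
  assumed total on the witness set only.\<close>

lemma lexord_total_on_lists:
  assumes "total_on A R"
  shows "total_on (lists A) (lexord R)"
proof -
  have "(xs, ys) \<in> lexord R \<or> xs = ys \<or> (ys, xs) \<in> lexord R"
    if "set xs \<subseteq> A" "set ys \<subseteq> A" for xs ys
    using that
  proof (induction xs arbitrary: ys)
    case Nil
    then show ?case by (cases ys) auto
  next
    case (Cons x xs)
    then show ?case using assms by (cases ys) (auto simp: total_on_def)
  qed
  then show ?thesis by (auto simp: total_on_def lists_eq_set)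
qed

context
  fixes W :: "witness set" and r :: "witness rel"
  assumes lin: "linear_order_on W r"
begin

lemma strict_order: "total_on W (r - Id)" "trans (r - Id)" "asym (r - Id)"
proof -
  have "antisym r" "trans r" "total_on W r"
    using lin by (auto simp: order_on_defs)
  then show "total_on W (r - Id)" "trans (r - Id)" "asym (r - Id)"
    by (auto simp: trans_diff_Id total_on_def asym_on_def antisym_def)
qed

lemma set_vec: "finite S \<Longrightarrow> S \<subseteq> W \<Longrightarrow> set (vec r S) = S"
proof -
  assume S: "finite S" "S \<subseteq> W"
  then have "total_on S (r - Id)" using strict_order(1) by (auto simp: total_on_def)
  then obtain xs where "set xs = S" "sorted_wrt (\<lambda>x y. (x, y) \<in> r - Id) xs"
    using sorted_wrt_exists S(1) strict_order by blast
  moreover from this have "vec r S = xs"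
    unfolding vec_def using sorted_wrt_unique[OF strict_order(3)]
    by (intro the_equality) auto
  ultimately show ?thesis by simp
qed

lemma state_less_trans: "trans (state_less r)"
  unfolding state_less_def
  by (intro trans_inv_image trans_lex_prod lexord_transI strict_order trans_less_than)

lemma state_less_asym: "asym (state_less r)"
proof -
  have "asym (lexord (less_than :: nat rel))" "asym (lexord (r - Id))"
    using strict_order by (auto intro!: lexord_asym asym_less_than)
  then show ?thesis
    unfolding state_less_def by (intro asym_inv_image asym_lex_prod)
qed

text \<open>Finiteness makes the comparison faithful: \<open>vec\<close> and
  \<open>sorted_list_of_set\<close> list exactly the elements of a finite set, so distinct states
  have distinct keys in the lexicographic product.\<close>

lemma state_less_total:
  "total_on {(b, S). finite b \<and> finite S \<and> S \<subseteq> W} (state_less r)"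
proof (rule total_onI, clarsimp)
  fix b b' :: "nat set" and S S' :: "witness set"
  assume fin: "finite b" "finite b'" "finite S" "S \<subseteq> W" "finite S'" "S' \<subseteq> W"
    and neq: "b = b' \<longrightarrow> S \<noteq> S'"
    and not: "((b', S'), (b, S)) \<notin> state_less r"
  show "((b, S), (b', S')) \<in> state_less r"
  proof (cases "b = b'")
    case True
    have "vec r S \<noteq> vec r S'" using True neq set_vec fin by metis
    moreover have "vec r S \<in> lists W" "vec r S' \<in> lists W" using set_vec fin by auto
    ultimately show ?thesis
      using lexord_total_on_lists[OF strict_order(1)] not True
      by (auto simp: state_less_def total_on_def)
  next
    case False
    then have "sorted_list_of_set b \<noteq> sorted_list_of_set b'"
      using fin by (metis sorted_list_of_set.set_sorted_key_list_of_set)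
    then show ?thesis
      using lexord_total_on_lists[of UNIV "less_than :: nat rel"] not
      by (auto simp: state_less_def total_on_def neq_iff)
  qed
qed

end

section \<open>Relabeling terms\<close>

primrec relabel_term :: "(nat \<Rightarrow> nat) \<Rightarrow> iterm \<Rightarrow> iterm" where
  "relabel_term p Leaf = Leaf"
| "relabel_term p (IntroVertex u \<sigma>) = IntroVertex (p u) (relabel_term p \<sigma>)"
| "relabel_term p (ForgetVertex u \<sigma>) = ForgetVertex (p u) (relabel_term p \<sigma>)"
| "relabel_term p (IntroEdge u v \<sigma>) = IntroEdge (p u) (p v) (relabel_term p \<sigma>)"
| "relabel_term p (Join \<sigma>\<^sub>1 \<sigma>\<^sub>2) = Join (relabel_term p \<sigma>\<^sub>1) (relabel_term p \<sigma>\<^sub>2)"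

lemma relabel_term_comp: "relabel_term p (relabel_term q \<tau>) = relabel_term (p \<circ> q) \<tau>"
  by (induction \<tau>) auto

lemma relabel_term_id: "relabel_term id \<tau> = \<tau>"
  by (induction \<tau>) auto

text \<open>Injectivity is used at \<open>ForgetVertex\<close>, where taking images must commute
  with removing a label.\<close>

lemma bag_relabel_term: "inj p \<Longrightarrow> bag (relabel_term p \<tau>) = p ` bag \<tau>"
  by (induction \<tau>) (auto simp: image_set_diff)

lemma itd_relabel_term:
  assumes "p permutes labels k" "itd k \<tau>"
  shows "itd k (relabel_term p \<tau>)"
proof -
  have "p u \<in> labels k \<longleftrightarrow> u \<in> labels k" for u using permutes_in_image[OF assms(1)] .
  then show ?thesis
    using assms(2) permutes_inj[OF assms(1)]
    by (induction \<tau>) (auto simp: bag_relabel_term inj_image_mem_iff inj_eq simp del: atLeastAtMost_iff)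
qed

lemma bag_subset_labels: "itd k \<tau> \<Longrightarrow> bag \<tau> \<subseteq> labels k"
  by (induction \<tau>) auto

section \<open>Relabelings as restrictions of permutations\<close>

definition map_on :: "(nat \<Rightarrow> nat) \<Rightarrow> nat set \<Rightarrow> nat \<rightharpoonup> nat" where
  "map_on p b = (\<lambda>u. if u \<in> b then Some (p u) else None)"

lemma dom_map_on [simp]: "dom (map_on p b) = b"
  by (auto simp: map_on_def split: if_splits)

lemma ran_map_on [simp]: "ran (map_on p b) = p ` b"
  by (auto simp: map_on_def ran_def)

lemma map_image_map_on [simp]: "map_image (map_on p b) b = p ` b"
  by (auto simp: map_image_def map_on_def)

lemma map_on_relabelings:
  assumes "p permutes labels k" "b \<subseteq> labels k"
  shows "map_on p b \<in> relabelings k"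
proof -
  have "p ` b \<subseteq> labels k" using assms permutes_image[OF assms(1)] by blast
  moreover have "inj_on (map_on p b) b"
    using permutes_inj[OF assms(1)] by (simp add: inj_on_def map_on_def)
  ultimately show ?thesis
    unfolding relabelings_def mem_Collect_eq dom_map_on ran_map_on using assms(2) by blast
qed

text \<open>Inside the finite label set the complements of domain and range have equal size, so some
  bijection \<open>h\<close> between them completes \<open>f\<close>.\<close>

lemma relabeling_extends_to_permutation:
  assumes "f \<in> relabelings k"
  obtains p where "p permutes labels k" "f = map_on p (dom f)"
proof -
  let ?b = "dom f" and ?g = "\<lambda>u. the (f u)"
  have b: "?b \<subseteq> labels k" "ran f \<subseteq> labels k" and inj: "inj_on f ?b"
    using assms by (auto simp: relabelings_def)
  have g: "bij_betw ?g ?b (ran f)"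
    using inj by (auto simp: bij_betw_def inj_on_def ran_def dom_def image_def)
  then have "card (labels k - ?b) = card (labels k - ran f)"
    using b by (simp add: card_Diff_subset finite_subset bij_betw_same_card)
  then obtain h where h: "bij_betw h (labels k - ?b) (labels k - ran f)"
    using finite_same_card_bij by (metis finite_Diff finite_atLeastAtMost)
  \<comment> \<open>Outside the label set \<open>permutes\<close> demands the identity.\<close>
  define p where "p = (\<lambda>u. if u \<in> ?b then ?g u else if u \<in> labels k then h u else u)"
  have "bij_betw p ?b (ran f)" using g by (rule bij_betw_cong[THEN iffD1, rotated]) (simp add: p_def)
  moreover have "bij_betw p (labels k - ?b) (labels k - ran f)"
    using h by (rule bij_betw_cong[THEN iffD1, rotated]) (auto simp: p_def)
  ultimately have "bij_betw p (?b \<union> (labels k - ?b)) (ran f \<union> (labels k - ran f))"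
    by (rule bij_betw_combine) auto
  then have "bij_betw p (labels k) (labels k)" using b by (simp add: Un_absorb1 Un_absorb2)
  then have "p permutes labels k"
    using b by (intro bij_imp_permutes) (auto simp: p_def)
  moreover have "f = map_on p ?b" by (rule ext) (auto simp: map_on_def p_def)
  ultimately show thesis using that by blast
qed


section \<open>Refutations as sequences of transitions\<close>

text \<open>Earlier states enter as a set \<open>A\<close> instead of through list positions, so
  appending to a derivation needs no reindexing. The rules describe the state before relabeling;
  \<open>relabels\<close> is applied afterwards.\<close>

inductive transition :: "nat \<Rightarrow> dp_tuple \<Rightarrow> action \<Rightarrow> state set \<Rightarrow> state \<Rightarrow> bool"
  for k C \<rho> A where
  intro_vertex: "(b, S) \<in> A \<Longrightarrow> u \<in> labels k \<Longrightarrow> u \<notin> b \<Longrightarrow>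
    transition k C \<rho> A (b \<union> {u}, intro_vertex_set C u S)"
| forget_vertex: "(b, S) \<in> A \<Longrightarrow> u \<in> b \<Longrightarrow>
    transition k C \<rho> A (b - {u}, forget_vertex_set C u S)"
| intro_edge: "(b, S) \<in> A \<Longrightarrow> u \<in> b \<Longrightarrow> v \<in> b \<Longrightarrow> u \<noteq> v \<Longrightarrow>
    transition k C \<rho> A (b, intro_edge_set C u v S)"
| join: "(b, S) \<in> A \<Longrightarrow> (b, S') \<in> A \<Longrightarrow> \<pi> \<in> relabelings k \<Longrightarrow> dom \<pi> = b \<Longrightarrow> ran \<pi> = b \<Longrightarrow>
    act_set \<rho> \<pi> S' = Some T \<Longrightarrow> transition k C \<rho> A (b, join_set C S T)"

text \<open>The part of a relabeled refutation that can be built step by step. Inconsistency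
  concerns the last state alone, and well-formedness will follow once the states are known to come
  from terms.\<close>

definition derivation ::
    "nat \<Rightarrow> dp_tuple \<Rightarrow> action \<Rightarrow> (nat \<rightharpoonup> nat) list \<Rightarrow> state list \<Rightarrow> bool" where
  "derivation k C \<rho> F sts \<longleftrightarrow> set F \<subseteq> relabelings k \<and> length sts = length F + 1 \<and>
     sts ! 0 = initial_state C \<and>
     (\<forall>i\<in>{1..length F}. \<exists>s. transition k C \<rho> (set (take i sts)) s \<and>
        relabels \<rho> (F ! (i - 1)) s (sts ! i))"

lemma in_set_take_iff: "i \<le> length xs \<Longrightarrow> x \<in> set (take i xs) \<longleftrightarrow> (\<exists>j<i. xs ! j = x)"
  by (auto simp: in_set_conv_nth)

text \<open>The content is the step condition: an earlier index corresponds to membership in the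
  prefix \<open>take i sts\<close>, and the four disjuncts correspond to the four rules of
  \<open>transition\<close>.\<close>

lemma relabeled_refutation_iff_derivation:
  "relabeled_refutation k C L \<rho> F sts \<longleftrightarrow> derivation k C \<rho> F sts \<and>
     (\<forall>s\<in>set sts. is_state k C s \<and> well_formed L s) \<and> inconsistent C (sts ! length F)"
proof -
  have "(\<exists>j<i. \<exists>b S. sts ! j = (b, S) \<and>
        ((\<exists>u\<in>labels k. u \<notin> b \<and> relabels \<rho> f (b \<union> {u}, intro_vertex_set C u S) t) \<or>
         (\<exists>u\<in>b. relabels \<rho> f (b - {u}, forget_vertex_set C u S) t) \<or>
         (\<exists>u\<in>b. \<exists>v\<in>b. u \<noteq> v \<and> relabels \<rho> f (b, intro_edge_set C u v S) t) \<or>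
         (\<exists>l<i. \<exists>S' \<pi> T. sts ! l = (b, S') \<and>
            \<pi> \<in> relabelings k \<and> dom \<pi> = b \<and> ran \<pi> = b \<and> act_set \<rho> \<pi> S' = Some T \<and>
            relabels \<rho> f (b, join_set C S T) t))) \<longleftrightarrow>
      (\<exists>s. transition k C \<rho> (set (take i sts)) s \<and> relabels \<rho> f s t)" (is "?A i f t \<longleftrightarrow> ?B i f t")
    if i: "i \<le> length sts" for i f t
  proof
    note mem = in_set_take_iff[OF i, THEN iffD2]
    assume "?A i f t"
    then obtain j b S where "j < i" "sts ! j = (b, S)" and
      cases: "(\<exists>u\<in>labels k. u \<notin> b \<and> relabels \<rho> f (b \<union> {u}, intro_vertex_set C u S) t) \<or>
         (\<exists>u\<in>b. relabels \<rho> f (b - {u}, forget_vertex_set C u S) t) \<or>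
         (\<exists>u\<in>b. \<exists>v\<in>b. u \<noteq> v \<and> relabels \<rho> f (b, intro_edge_set C u v S) t) \<or>
         (\<exists>l<i. \<exists>S' \<pi> T. sts ! l = (b, S') \<and>
            \<pi> \<in> relabelings k \<and> dom \<pi> = b \<and> ran \<pi> = b \<and> act_set \<rho> \<pi> S' = Some T \<and>
            relabels \<rho> f (b, join_set C S T) t)"
      by blast
    then have "(b, S) \<in> set (take i sts)" using mem by blast
    note tr = transition.intros[where A = "set (take i sts)" and k = k and C = C and \<rho> = \<rho>]
    from cases show "?B i f t"
    proof (elim disjE)
      assume "\<exists>u\<in>labels k. u \<notin> b \<and> relabels \<rho> f (b \<union> {u}, intro_vertex_set C u S) t"
      then show "?B i f t" using tr(1)[OF \<open>(b, S) \<in> _\<close>] by blast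
    next
      assume "\<exists>u\<in>b. relabels \<rho> f (b - {u}, forget_vertex_set C u S) t"
      then show "?B i f t" using tr(2)[OF \<open>(b, S) \<in> _\<close>] by blast
    next
      assume "\<exists>u\<in>b. \<exists>v\<in>b. u \<noteq> v \<and> relabels \<rho> f (b, intro_edge_set C u v S) t"
      then show "?B i f t" using tr(3)[OF \<open>(b, S) \<in> _\<close>] by blast
    next
      assume "\<exists>l<i. \<exists>S' \<pi> T. sts ! l = (b, S') \<and>
            \<pi> \<in> relabelings k \<and> dom \<pi> = b \<and> ran \<pi> = b \<and> act_set \<rho> \<pi> S' = Some T \<and>
            relabels \<rho> f (b, join_set C S T) t"
      then obtain l S' \<pi> T where l: "l < i" "sts ! l = (b, S')" and
        \<pi>: "\<pi> \<in> relabelings k" "dom \<pi> = b" "ran \<pi> = b" "act_set \<rho> \<pi> S' = Some T"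
        "relabels \<rho> f (b, join_set C S T) t" by blast
      have "(b, S') \<in> set (take i sts)" using mem l by blast
      then show "?B i f t" using tr(4)[OF \<open>(b, S) \<in> _\<close> _ \<pi>(1-4)] \<pi>(5) by blast
    qed
  next
    note mem = in_set_take_iff[OF i]
    assume "?B i f t"
    then obtain s where s: "transition k C \<rho> (set (take i sts)) s" "relabels \<rho> f s t" by blast
    from s(1) show "?A i f t"
    proof cases
      case (intro_vertex b S u)
      then show ?thesis using s(2) mem by blast
    next
      case (forget_vertex b S u)
      then show ?thesis using s(2) mem by blast
    next
      case (intro_edge b S u v)
      then show ?thesis using s(2) mem by blast
    next
      case (join b S S' \<pi> T)
      then obtain j l where "j < i" "sts ! j = (b, S)" "l < i" "sts ! l = (b, S')"
        using mem by blast
      then show ?thesis using s(2) join by blast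
    qed
  qed
  note step = this
  have "(\<forall>i\<in>{1..length F}. ?A i (F ! (i - 1)) (sts ! i)) \<longleftrightarrow>
      (\<forall>i\<in>{1..length F}. ?B i (F ! (i - 1)) (sts ! i))" if "length sts = length F + 1"
    using that by (intro ball_cong refl step) simp
  then show ?thesis
    unfolding relabeled_refutation_def derivation_def
    by (intro iffI; elim conjE) (intro conjI; (assumption | (drule (1) meta_mp, erule (1) iffD1 iffD2)))+
qed

lemma derivation_snoc:
  assumes "derivation k C \<rho> F sts" "transition k C \<rho> (set sts) s" "f \<in> relabelings k"
    "relabels \<rho> f s t"
  shows "derivation k C \<rho> (F @ [f]) (sts @ [t])"
proof -
  have len: "length sts = length F + 1" using assms(1) by (simp add: derivation_def)
  have "\<exists>s. transition k C \<rho> (set (take i (sts @ [t]))) s \<and>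
      relabels \<rho> ((F @ [f]) ! (i - 1)) s ((sts @ [t]) ! i)"
    if "i \<in> {1..length (F @ [f])}" for i
  proof (cases "i \<le> length F")
    case True
    then have "i \<in> {1..length F}" using that by simp
    then show ?thesis
      using assms(1) True len by (auto simp: derivation_def nth_append)
  next
    case False
    then have "i = length sts" using that len by simp
    then show ?thesis using assms(2,4) len by (intro exI[of _ s]) (simp add: nth_append)
  qed
  then show ?thesis
    using assms(1,3) len unfolding derivation_def
    by (intro conjI ballI) (simp_all add: nth_append)
qed

text \<open>Serves to cut a derivation right after a state of interest, since a refutation must end
  with its inconsistent state. Keeping \<open>n\<close> relabelings means keeping
  \<open>n + 1\<close> states.\<close>

lemma derivation_take:
  assumes "derivation k C \<rho> F sts" "n \<le> length F"
  shows "derivation k C \<rho> (take n F) (take (n + 1) sts)"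
  using assms unfolding derivation_def
  by (auto simp: min_def dest: in_set_takeD)

text \<open>Everything here takes place at a single level \<open>k\<close>; coherence relates
  different levels and enters in the final theorem.\<close>

locale core_with_action =
  fixes D :: "nat \<Rightarrow> dp_tuple" and Lbl :: "nat \<Rightarrow> witness \<Rightarrow> nat set"
    and \<rho> :: "nat \<Rightarrow> action" and k :: nat
  assumes core: "dp_core D"
    and labelling: "label_assignment D Lbl"
    and interface: "interface_respecting D Lbl"
    and cleaning: "identity_cleaning D"
    and action: "witness_action k (D k) (Lbl k) (\<rho> k)"
begin

abbreviation "C \<equiv> D k"
abbreviation "L \<equiv> Lbl k"

section \<open>Dynamization of relabeled terms\<close>

lemma fin_subset_transitions:
  "fin_subset (leaf C) C"
  "fin_subset S C \<Longrightarrow> u \<in> labels k \<Longrightarrow> fin_subset (intro_vertex_set C u S) C"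
  "fin_subset S C \<Longrightarrow> u \<in> labels k \<Longrightarrow> fin_subset (forget_vertex_set C u S) C"
  "fin_subset S C \<Longrightarrow> u \<in> labels k \<Longrightarrow> v \<in> labels k \<Longrightarrow> u \<noteq> v \<Longrightarrow>
     fin_subset (intro_edge_set C u v S) C"
  "fin_subset S C \<Longrightarrow> fin_subset S' C \<Longrightarrow> fin_subset (join_set C S S') C"
proof -
  have *: "fin_subset (\<Union>w\<in>S. h w) C" if "fin_subset S C" "\<And>w. w \<in> wit C \<Longrightarrow> fin_subset (h w) C"
    for S h using that by (auto simp: fin_subset_def)
  note core' = core[unfolded dp_core_def, rule_format, of k]
  show "fin_subset (leaf C) C" using core' by blast
  show "fin_subset (intro_vertex_set C u S) C" if "fin_subset S C" "u \<in> labels k"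
    unfolding intro_vertex_set_def using core' that by (intro *) blast+
  show "fin_subset (forget_vertex_set C u S) C" if "fin_subset S C" "u \<in> labels k"
    unfolding forget_vertex_set_def using core' that by (intro *) blast+
  show "fin_subset (intro_edge_set C u v S) C"
    if "fin_subset S C" "u \<in> labels k" "v \<in> labels k" "u \<noteq> v"
    unfolding intro_edge_set_def using core' that by (intro *) blast+
  show "fin_subset (join_set C S S') C" if "fin_subset S C" "fin_subset S' C"
    unfolding join_set_def using core' that by (intro *) blast+
qed

lemma clean_id: "fin_subset S C \<Longrightarrow> clean C S = S"
  using cleaning by (auto simp: identity_cleaning_def)

lemma fin_subset_dyn: "itd k \<tau> \<Longrightarrow> fin_subset (dyn C \<tau>) C"
  by (induction \<tau>) (auto simp: clean_id fin_subset_transitions simp del: atLeastAtMost_iff)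

text \<open>Identity cleaning is given on finite sets of witnesses, so legality of the term is used
  to know that each intermediate result is such a set.\<close>

lemma dyn_simps:
  "itd k (IntroVertex u \<sigma>) \<Longrightarrow> dyn C (IntroVertex u \<sigma>) = intro_vertex_set C u (dyn C \<sigma>)"
  "itd k (ForgetVertex u \<sigma>) \<Longrightarrow> dyn C (ForgetVertex u \<sigma>) = forget_vertex_set C u (dyn C \<sigma>)"
  "itd k (IntroEdge u v \<sigma>) \<Longrightarrow> dyn C (IntroEdge u v \<sigma>) = intro_edge_set C u v (dyn C \<sigma>)"
  "itd k (Join \<sigma>\<^sub>1 \<sigma>\<^sub>2) \<Longrightarrow> dyn C (Join \<sigma>\<^sub>1 \<sigma>\<^sub>2) = join_set C (dyn C \<sigma>\<^sub>1) (dyn C \<sigma>\<^sub>2)"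
  by (auto simp: clean_id fin_subset_transitions fin_subset_dyn simp del: atLeastAtMost_iff)

lemma Lbl_transitions:
  assumes "b \<subseteq> labels k" "fin_subset S C" "fin_subset S' C" "Lbl_set L S \<subseteq> b" "Lbl_set L S' \<subseteq> b"
  shows "u \<in> labels k \<Longrightarrow> u \<notin> b \<Longrightarrow> Lbl_set L (intro_vertex_set C u S) \<subseteq> b \<union> {u}"
    and "u \<in> b \<Longrightarrow> Lbl_set L (forget_vertex_set C u S) \<subseteq> b - {u}"
    and "u \<in> b \<Longrightarrow> v \<in> b \<Longrightarrow> u \<noteq> v \<Longrightarrow> Lbl_set L (intro_edge_set C u v S) \<subseteq> b"
    and "Lbl_set L (join_set C S S') \<subseteq> b"
proof -
  note * = interface[unfolded interface_respecting_def, THEN spec[of _ k], THEN conjunct2, THEN spec,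
      THEN spec, THEN spec, THEN mp, OF assms(1), THEN mp, OF assms(2), THEN mp, OF assms(3), THEN mp,
      OF assms(4), THEN mp, OF assms(5)]
  show "u \<in> labels k \<Longrightarrow> u \<notin> b \<Longrightarrow> Lbl_set L (intro_vertex_set C u S) \<subseteq> b \<union> {u}"
    using * by (elim conjE) (drule (1) bspec[of "labels k"], erule (1) mp)
  show "u \<in> b \<Longrightarrow> Lbl_set L (forget_vertex_set C u S) \<subseteq> b - {u}"
    using * by (elim conjE) (erule (1) bspec)
  show "u \<in> b \<Longrightarrow> v \<in> b \<Longrightarrow> u \<noteq> v \<Longrightarrow> Lbl_set L (intro_edge_set C u v S) \<subseteq> b"
    using * by (elim conjE) (drule (1) bspec[of b], drule (1) bspec[of b], erule (1) mp)
  show "Lbl_set L (join_set C S S') \<subseteq> b"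
    using * by (elim conjE)
qed

text \<open>Besides well-formedness, this ensures that a relabeling with domain
  \<open>bag \<tau>\<close> is defined on the whole dynamization.\<close>

lemma Lbl_dyn: "itd k \<tau> \<Longrightarrow> Lbl_set L (dyn C \<tau>) \<subseteq> bag \<tau>"
proof (induction \<tau>)
  case Leaf
  then show ?case using interface by (auto simp: interface_respecting_def)
next
  case (IntroVertex u \<sigma>)
  then have \<sigma>: "itd k \<sigma>" "u \<in> labels k" "u \<notin> bag \<sigma>" by auto
  \<comment> \<open>\<open>Lbl_transitions\<close> speaks of two witness sets because of the join;
    for a unary instruction the same set serves as both.\<close>
  have "Lbl_set L (intro_vertex_set C u (dyn C \<sigma>)) \<subseteq> bag \<sigma> \<union> {u}"
    using bag_subset_labels fin_subset_dyn IntroVertex.IH \<sigma>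
    by (intro Lbl_transitions(1)[where S' = "dyn C \<sigma>"])
  then show ?case unfolding dyn_simps(1)[OF IntroVertex.prems] by simp
next
  case (ForgetVertex u \<sigma>)
  then have \<sigma>: "itd k \<sigma>" "u \<in> bag \<sigma>" by auto
  have "Lbl_set L (forget_vertex_set C u (dyn C \<sigma>)) \<subseteq> bag \<sigma> - {u}"
    using bag_subset_labels fin_subset_dyn ForgetVertex.IH \<sigma>
    by (intro Lbl_transitions(2)[where S' = "dyn C \<sigma>"])
  then show ?case unfolding dyn_simps(2)[OF ForgetVertex.prems] by simp
next
  case (IntroEdge u v \<sigma>)
  then have \<sigma>: "itd k \<sigma>" "u \<in> bag \<sigma>" "v \<in> bag \<sigma>" "u \<noteq> v" by auto
  have "Lbl_set L (intro_edge_set C u v (dyn C \<sigma>)) \<subseteq> bag \<sigma>"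
    using bag_subset_labels fin_subset_dyn IntroEdge.IH \<sigma>
    by (intro Lbl_transitions(3)[where S' = "dyn C \<sigma>"])
  then show ?case unfolding dyn_simps(3)[OF IntroEdge.prems] by simp
next
  case (Join \<sigma>\<^sub>1 \<sigma>\<^sub>2)
  then have \<sigma>: "itd k \<sigma>\<^sub>1" "itd k \<sigma>\<^sub>2" "bag \<sigma>\<^sub>1 = bag \<sigma>\<^sub>2" by auto
  have "Lbl_set L (join_set C (dyn C \<sigma>\<^sub>1) (dyn C \<sigma>\<^sub>2)) \<subseteq> bag \<sigma>\<^sub>1"
    using bag_subset_labels[OF \<sigma>(1)] fin_subset_dyn Join.IH \<sigma> by (intro Lbl_transitions) auto
  then show ?case unfolding dyn_simps(4)[OF Join.prems] by simp
qed

section \<open>The action of permutations on witnesses\<close>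

lemmas action_axioms_unfolded = action[unfolded witness_action_def]

lemma action_defined: "f \<in> relabelings k \<Longrightarrow> w \<in> wit C \<Longrightarrow> L w \<subseteq> dom f \<Longrightarrow> \<exists>x. \<rho> k f w = Some x"
  using action_axioms_unfolded[THEN conjunct1, rule_format, of f w] by simp

lemma action_some:
  assumes "f \<in> relabelings k" "w \<in> wit C" "\<rho> k f w = Some x"
  shows "x \<in> wit C" "\<rho> k (map_inverse f) x = Some w" "final C x = final C w"
  using action_axioms_unfolded[THEN conjunct1, THEN bspec, OF assms(1), THEN bspec, OF assms(2)]
    assms(3) by simp_all

lemma action_comp:
  assumes "f \<in> relabelings k" "f' \<in> relabelings k" "w \<in> wit C"
    "\<rho> k f' w = Some x" "\<rho> k f x = Some y"
  shows "\<rho> k (f \<circ>\<^sub>m f') w = Some y"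
  by (rule action_axioms_unfolded[THEN conjunct2, THEN conjunct1, rule_format, OF assms])

lemma action_extend:
  assumes "f \<in> relabelings k" "f' \<in> relabelings k" "w \<in> wit C" "f \<subseteq>\<^sub>m f'" "\<rho> k f w = Some x"
  shows "\<rho> k f' w = Some x"
  by (rule action_axioms_unfolded[THEN conjunct2, THEN conjunct2, THEN conjunct1, rule_format, OF assms])

lemma action_equivariant:
  assumes "f \<in> relabelings k" "w \<in> wit C" "\<rho> k f w = Some x"
  shows "u \<in> dom f \<Longrightarrow> act_set (\<rho> k) f (intro_vertex C u w) = Some T \<Longrightarrow>
      T = intro_vertex C (the (f u)) x"
    and "u \<in> dom f \<Longrightarrow> act_set (\<rho> k) f (forget_vertex C u w) = Some T \<Longrightarrow>
      T = forget_vertex C (the (f u)) x"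
    and "u \<in> dom f \<Longrightarrow> v \<in> dom f \<Longrightarrow> u \<noteq> v \<Longrightarrow> act_set (\<rho> k) f (intro_edge C u v w) = Some T \<Longrightarrow>
      T = intro_edge C (the (f u)) (the (f v)) x"
    and "w' \<in> wit C \<Longrightarrow> \<rho> k f w' = Some x' \<Longrightarrow> act_set (\<rho> k) f (join C w w') = Some T \<Longrightarrow>
      T = join C x x'"
proof -
  note * = action_axioms_unfolded[THEN conjunct2, THEN conjunct2, THEN conjunct2, THEN bspec,
      OF assms(1), THEN bspec, OF assms(2), THEN spec, THEN spec, THEN mp, OF assms(3)]
  show "u \<in> dom f \<Longrightarrow> act_set (\<rho> k) f (intro_vertex C u w) = Some T \<Longrightarrow>
      T = intro_vertex C (the (f u)) x"
    by (rule *[THEN conjunct1, rule_format])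
  show "u \<in> dom f \<Longrightarrow> act_set (\<rho> k) f (forget_vertex C u w) = Some T \<Longrightarrow>
      T = forget_vertex C (the (f u)) x"
    by (rule *[THEN conjunct2, THEN conjunct1, rule_format])
  show "u \<in> dom f \<Longrightarrow> v \<in> dom f \<Longrightarrow> u \<noteq> v \<Longrightarrow> act_set (\<rho> k) f (intro_edge C u v w) = Some T \<Longrightarrow>
      T = intro_edge C (the (f u)) (the (f v)) x"
    by (rule *[THEN conjunct2, THEN conjunct2, THEN conjunct1, rule_format])
  show "w' \<in> wit C \<Longrightarrow> \<rho> k f w' = Some x' \<Longrightarrow> act_set (\<rho> k) f (join C w w') = Some T \<Longrightarrow>
      T = join C x x'"
    by (rule *[THEN conjunct2, THEN conjunct2, THEN conjunct2, rule_format])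
qed

text \<open>With the full label set as domain the action is defined on every witness, so
  \<open>the\<close> never meets \<open>None\<close> when \<open>p\<close> permutes the labels and
  \<open>w\<close> is a witness.\<close>

definition move :: "(nat \<Rightarrow> nat) \<Rightarrow> witness \<Rightarrow> witness" where
  "move p w = the (\<rho> k (map_on p (labels k)) w)"

lemma Lbl_wit: "w \<in> wit C \<Longrightarrow> L w \<subseteq> labels k"
  using labelling by (simp add: label_assignment_def)

text \<open>By the extension law the result does not depend on the domain \<open>b\<close>, as long
  as \<open>b\<close> contains the labels of \<open>w\<close>. Hence \<open>move\<close> computes
  all relabelings of bags.\<close>

lemma action_map_on:
  assumes "p permutes labels k" "b \<subseteq> labels k" "w \<in> wit C" "L w \<subseteq> b"
  shows "\<rho> k (map_on p b) w = Some (move p w)"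
proof -
  obtain x where x: "\<rho> k (map_on p b) w = Some x"
    using action_defined[OF map_on_relabelings[OF assms(1,2)] assms(3)] assms(4) by auto
  have "map_on p b \<subseteq>\<^sub>m map_on p (labels k)" using assms(2) by (auto simp: map_on_def map_le_def)
  then have "\<rho> k (map_on p (labels k)) w = Some x"
    using action_extend[OF map_on_relabelings map_on_relabelings] x assms by blast
  then show ?thesis using x by (simp add: move_def)
qed

lemma act_set_map_on:
  assumes "p permutes labels k" "b \<subseteq> labels k" "S \<subseteq> wit C" "Lbl_set L S \<subseteq> b"
  shows "act_set (\<rho> k) (map_on p b) S = Some (move p ` S)"
proof -
  have "\<rho> k (map_on p b) w = Some (move p w)" if "w \<in> S" for w
    using action_map_on[OF assms(1,2), of w] assms(3,4) that by (auto simp: Lbl_set_def)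
  then show ?thesis by (auto simp: act_set_def)
qed

lemma move_wit:
  assumes "p permutes labels k" "w \<in> wit C"
  shows "move p w \<in> wit C" "final C (move p w) = final C w"
  using action_some(1,3)[OF map_on_relabelings[OF assms(1) subset_refl] assms(2)
      action_map_on[OF assms(1) subset_refl assms(2) Lbl_wit[OF assms(2)]]] .

text \<open>The equivariance laws presuppose that the action is defined on the result of the
  transition; for the full domain this always holds, so the laws become unconditional
  equations.\<close>

lemma move_transitions:
  assumes p: "p permutes labels k" and w: "w \<in> wit C"
  shows "u \<in> labels k \<Longrightarrow> move p ` intro_vertex C u w = intro_vertex C (p u) (move p w)"
    and "u \<in> labels k \<Longrightarrow> move p ` forget_vertex C u w = forget_vertex C (p u) (move p w)"
    and "u \<in> labels k \<Longrightarrow> v \<in> labels k \<Longrightarrow> u \<noteq> v \<Longrightarrow>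
      move p ` intro_edge C u v w = intro_edge C (p u) (p v) (move p w)"
    and "w' \<in> wit C \<Longrightarrow> move p ` join C w w' = join C (move p w) (move p w')"
proof -
  let ?P = "map_on p (labels k)"
  have P: "?P \<in> relabelings k" using map_on_relabelings[OF p] by blast
  have act: "\<rho> k ?P x = Some (move p x)" if "x \<in> wit C" for x
    using action_map_on[OF p _ that Lbl_wit[OF that]] by blast
  have acts: "act_set (\<rho> k) ?P S = Some (move p ` S)" if "fin_subset S C" for S
    using act_set_map_on[OF p subset_refl, of S] that Lbl_wit by (fastforce simp: fin_subset_def Lbl_set_def)
  have the_P: "the (?P x) = p x" if "x \<in> labels k" for x using that by (simp add: map_on_def)
  \<comment> \<open>The closure facts concern lifted transitions; a singleton turns them into facts
    about one witness.\<close>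
  have fin: "fin_subset {w} C" using w by (simp add: fin_subset_def)
  note eqv = action_equivariant[OF P w act[OF w], unfolded dom_map_on]
  show "move p ` intro_vertex C u w = intro_vertex C (p u) (move p w)" if "u \<in> labels k"
    using eqv(1)[OF that acts] fin_subset_transitions(2)[OF fin that] the_P[OF that]
    by (simp add: intro_vertex_set_def)
  show "move p ` forget_vertex C u w = forget_vertex C (p u) (move p w)" if "u \<in> labels k"
    using eqv(2)[OF that acts] fin_subset_transitions(3)[OF fin that] the_P[OF that]
    by (simp add: forget_vertex_set_def)
  show "move p ` intro_edge C u v w = intro_edge C (p u) (p v) (move p w)"
    if "u \<in> labels k" "v \<in> labels k" "u \<noteq> v"
    using eqv(3)[OF that acts] fin_subset_transitions(4)[OF fin that] the_P[OF that(1)] the_P[OF that(2)]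
    by (simp add: intro_edge_set_def)
  show "move p ` join C w w' = join C (move p w) (move p w')" if "w' \<in> wit C"
    using eqv(4)[OF that act[OF that] acts] fin_subset_transitions(5)[OF fin, of "{w'}"] that
    by (simp add: join_set_def fin_subset_def)
qed

text \<open>The axioms of a witness action do not state that the empty relabeling acts as the identity.
  It does because it is its own inverse and idempotent.\<close>

lemma move_unlabelled:
  assumes p: "p permutes labels k" and w: "w \<in> wit C" "L w = {}"
  shows "move p w = w"
proof -
  have e: "Map.empty \<in> relabelings k" by (simp add: relabelings_def)
  have e': "map_on p {} = Map.empty" by (simp add: map_on_def)
  have x: "\<rho> k Map.empty w = Some (move p w)"
    using action_map_on[OF p, of "{}" w] w e' by simp
  have "\<rho> k Map.empty (move p w) = Some w"
    using action_some(2)[OF e w(1) x] by (simp add: map_inverse_def)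
  from action_comp[OF e e w(1) x this] x show ?thesis
    by (simp add: map_comp_def)
qed

lemma move_set_transitions:
  assumes p: "p permutes labels k" and S: "fin_subset S C"
  shows "u \<in> labels k \<Longrightarrow> move p ` intro_vertex_set C u S = intro_vertex_set C (p u) (move p ` S)"
    and "u \<in> labels k \<Longrightarrow> move p ` forget_vertex_set C u S = forget_vertex_set C (p u) (move p ` S)"
    and "u \<in> labels k \<Longrightarrow> v \<in> labels k \<Longrightarrow> u \<noteq> v \<Longrightarrow>
      move p ` intro_edge_set C u v S = intro_edge_set C (p u) (p v) (move p ` S)"
    and "fin_subset S' C \<Longrightarrow> move p ` join_set C S S' = join_set C (move p ` S) (move p ` S')"
proof -
  have w: "w \<in> wit C" if "w \<in> S" for w using S that by (auto simp: fin_subset_def)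
  show "move p ` intro_vertex_set C u S = intro_vertex_set C (p u) (move p ` S)"
    if "u \<in> labels k"
    unfolding intro_vertex_set_def image_UN image_image
    using move_transitions(1)[OF p w that] by (intro SUP_cong) auto
  show "move p ` forget_vertex_set C u S = forget_vertex_set C (p u) (move p ` S)"
    if "u \<in> labels k"
    unfolding forget_vertex_set_def image_UN image_image
    using move_transitions(2)[OF p w that] by (intro SUP_cong) auto
  show "move p ` intro_edge_set C u v S = intro_edge_set C (p u) (p v) (move p ` S)"
    if "u \<in> labels k" "v \<in> labels k" "u \<noteq> v"
    unfolding intro_edge_set_def image_UN image_image
    using move_transitions(3)[OF p w that] by (intro SUP_cong) auto
  show "move p ` join_set C S S' = join_set C (move p ` S) (move p ` S')" if "fin_subset S' C"
    unfolding join_set_def image_UN image_image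
    using move_transitions(4)[OF p w] that by (intro SUP_cong) (auto simp: fin_subset_def subset_eq)
qed

lemma dyn_relabel_term:
  assumes p: "p permutes labels k" and "itd k \<tau>"
  shows "dyn C (relabel_term p \<tau>) = move p ` dyn C \<tau>"
  using assms(2)
proof (induction \<tau>)
  case Leaf
  \<comment> \<open>Interface respect leaves the leaf witnesses without labels, so every permutation
    fixes each of them.\<close>
  have "L w = {}" "w \<in> wit C" if "w \<in> leaf C" for w
    using that interface fin_subset_transitions(1)
    by (auto simp: interface_respecting_def Lbl_set_def fin_subset_def)
  then have "move p ` leaf C = id ` leaf C" using move_unlabelled[OF p] by (intro image_cong) auto
  then show ?case by simp
next
  case (IntroVertex u \<sigma>)
  then have \<sigma>: "itd k \<sigma>" "u \<in> labels k" by auto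
  show ?case
    using dyn_simps(1)[OF IntroVertex.prems] IntroVertex.IH[OF \<sigma>(1)]
      dyn_simps(1)[OF itd_relabel_term[OF p IntroVertex.prems, unfolded relabel_term.simps]]
      move_set_transitions(1)[OF p fin_subset_dyn[OF \<sigma>(1)] \<sigma>(2)]
    by simp
next
  case (ForgetVertex u \<sigma>)
  then have \<sigma>: "itd k \<sigma>" "u \<in> labels k" by auto
  show ?case
    using dyn_simps(2)[OF ForgetVertex.prems] ForgetVertex.IH[OF \<sigma>(1)]
      dyn_simps(2)[OF itd_relabel_term[OF p ForgetVertex.prems, unfolded relabel_term.simps]]
      move_set_transitions(2)[OF p fin_subset_dyn[OF \<sigma>(1)] \<sigma>(2)]
    by simp
next
  case (IntroEdge u v \<sigma>)
  then have \<sigma>: "itd k \<sigma>" "u \<in> labels k" "v \<in> labels k" "u \<noteq> v" by auto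
  show ?case
    using dyn_simps(3)[OF IntroEdge.prems] IntroEdge.IH[OF \<sigma>(1)]
      dyn_simps(3)[OF itd_relabel_term[OF p IntroEdge.prems, unfolded relabel_term.simps]]
      move_set_transitions(3)[OF p fin_subset_dyn[OF \<sigma>(1)] \<sigma>(2-4)]
    by simp
next
  case (Join \<sigma>\<^sub>1 \<sigma>\<^sub>2)
  then have \<sigma>: "itd k \<sigma>\<^sub>1" "itd k \<sigma>\<^sub>2" by auto
  show ?case
    using dyn_simps(4)[OF Join.prems] Join.IH(1)[OF \<sigma>(1)] Join.IH(2)[OF \<sigma>(2)]
      dyn_simps(4)[OF itd_relabel_term[OF p Join.prems, unfolded relabel_term.simps]]
      move_set_transitions(4)[OF p fin_subset_dyn[OF \<sigma>(1)] fin_subset_dyn[OF \<sigma>(2)]]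
    by simp
qed

section \<open>States of terms\<close>

definition state_of :: "iterm \<Rightarrow> state" where
  "state_of \<tau> = (bag \<tau>, dyn C \<tau>)"

lemma state_of_well_formed: "itd k \<tau> \<Longrightarrow> is_state k C (state_of \<tau>) \<and> well_formed L (state_of \<tau>)"
  using bag_subset_labels[of k \<tau>] fin_subset_dyn[of \<tau>] Lbl_dyn[of \<tau>]
  by (simp add: state_of_def is_state_def well_formed_def)

lemma relabels_state_of:
  assumes "p permutes labels k" "itd k \<tau>"
  shows "relabels (\<rho> k) (map_on p (bag \<tau>)) (state_of \<tau>) (state_of (relabel_term p \<tau>))"
  using act_set_map_on[OF assms(1) bag_subset_labels[OF assms(2)] _ Lbl_dyn[OF assms(2)]]
    fin_subset_dyn[OF assms(2)] dyn_relabel_term[OF assms] permutes_inj[OF assms(1)]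
  by (simp add: relabels_def state_of_def bag_relabel_term fin_subset_def)

text \<open>Identifies the set minimized by \<open>CAN\<close>: every relabeling is the restriction
  of a permutation, and \<open>relabels\<close> determines its target from the map and the
  source.\<close>

lemma relabels_state_of_iff:
  assumes "itd k \<tau>"
  shows "(\<exists>f\<in>relabelings k. relabels (\<rho> k) f (state_of \<tau>) s) \<longleftrightarrow>
    (\<exists>p. p permutes labels k \<and> s = state_of (relabel_term p \<tau>))"
proof
  assume "\<exists>f\<in>relabelings k. relabels (\<rho> k) f (state_of \<tau>) s"
  then obtain f where f: "f \<in> relabelings k" "relabels (\<rho> k) f (state_of \<tau>) s" by blast
  obtain p where p: "p permutes labels k" "f = map_on p (dom f)"
    using relabeling_extends_to_permutation[OF f(1)] .
  have "dom f = bag \<tau>" using f(2) by (auto simp: relabels_def state_of_def)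
  then have "s = state_of (relabel_term p \<tau>)"
    using f(2) p relabels_state_of[OF p(1) assms]
    by (auto simp: relabels_def split: prod.splits)
  then show "\<exists>p. p permutes labels k \<and> s = state_of (relabel_term p \<tau>)" using p(1) by blast
next
  assume "\<exists>p. p permutes labels k \<and> s = state_of (relabel_term p \<tau>)"
  then show "\<exists>f\<in>relabelings k. relabels (\<rho> k) f (state_of \<tau>) s"
    using relabels_state_of[OF _ assms] map_on_relabelings[OF _ bag_subset_labels[OF assms]] by blast
qed

lemma transition_state_of:
  assumes A: "A \<subseteq> state_of ` {\<tau>. itd k \<tau>}" and s: "transition k C (\<rho> k) A s"
  shows "s \<in> state_of ` {\<tau>. itd k \<tau>}"
  using s
proof cases
  case (intro_vertex b S u)
  then obtain \<sigma> where \<sigma>: "itd k \<sigma>" "b = bag \<sigma>" "S = dyn C \<sigma>" using A by (auto simp: state_of_def)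
  then have "itd k (IntroVertex u \<sigma>)" using intro_vertex by simp
  moreover from dyn_simps(1)[OF this] have "s = state_of (IntroVertex u \<sigma>)"
    using intro_vertex \<sigma> by (simp add: state_of_def)
  ultimately show ?thesis by blast
next
  case (forget_vertex b S u)
  then obtain \<sigma> where \<sigma>: "itd k \<sigma>" "b = bag \<sigma>" "S = dyn C \<sigma>" using A by (auto simp: state_of_def)
  then have "itd k (ForgetVertex u \<sigma>)"
    using forget_vertex bag_subset_labels[OF \<sigma>(1)] by auto
  moreover from dyn_simps(2)[OF this] have "s = state_of (ForgetVertex u \<sigma>)"
    using forget_vertex \<sigma> by (simp add: state_of_def)
  ultimately show ?thesis by blast
next
  case (intro_edge b S u v)
  then obtain \<sigma> where \<sigma>: "itd k \<sigma>" "b = bag \<sigma>" "S = dyn C \<sigma>" using A by (auto simp: state_of_def)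
  then have "itd k (IntroEdge u v \<sigma>)"
    using intro_edge bag_subset_labels[OF \<sigma>(1)] by auto
  moreover from dyn_simps(3)[OF this] have "s = state_of (IntroEdge u v \<sigma>)"
    using intro_edge \<sigma> by (simp add: state_of_def)
  ultimately show ?thesis by blast
next
  case (join b S S' \<pi> T)
  then obtain \<sigma> \<sigma>' where \<sigma>: "itd k \<sigma>" "b = bag \<sigma>" "S = dyn C \<sigma>"
    and \<sigma>': "itd k \<sigma>'" "(b, S') = state_of \<sigma>'"
    using A unfolding state_of_def by blast
  \<comment> \<open>The permutation \<open>\<pi>\<close> is itself a relabeling of the second state.
    Thus \<open>(b, T)\<close> is the state of a permuted version of \<open>\<sigma>'\<close>, which
    has bag \<open>b\<close> and can legally be joined with \<open>\<sigma>\<close>.\<close>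
  have "map_image \<pi> b = b" using join by (auto simp: map_image_def ran_def dom_def)
  then have "relabels (\<rho> k) \<pi> (state_of \<sigma>') (b, T)"
    using join unfolding \<sigma>'(2)[symmetric] by (simp add: relabels_def)
  then obtain p where p: "p permutes labels k" "(b, T) = state_of (relabel_term p \<sigma>')"
    using relabels_state_of_iff[OF \<sigma>'(1)] join by blast
  then have "itd k (Join \<sigma> (relabel_term p \<sigma>'))"
    using \<sigma> itd_relabel_term[OF p(1) \<sigma>'(1)] by (auto simp: state_of_def)
  moreover from dyn_simps(4)[OF this] have "s = state_of (Join \<sigma> (relabel_term p \<sigma>'))"
    using join \<sigma> p(2) by (auto simp: state_of_def)
  ultimately show ?thesis by blast
qed

text \<open>Strong induction on the position, since a step may refer to any earlier states. The
  transition builds a term and the relabeling then permutes its labels.\<close>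

lemma derivation_state_of:
  assumes "derivation k C (\<rho> k) F sts" "i < length sts"
  shows "sts ! i \<in> state_of ` {\<tau>. itd k \<tau>}"
  using assms(2)
proof (induction i rule: less_induct)
  case (less i)
  show ?case
  proof (cases "i = 0")
    case True
    have "initial_state C = state_of Leaf" by (simp add: initial_state_def state_of_def)
    then show ?thesis using True assms(1) by (auto simp: derivation_def)
  next
    case False
    then have i: "i \<in> {1..length F}" using less.prems assms(1) by (auto simp: derivation_def)
    then obtain s where s: "transition k C (\<rho> k) (set (take i sts)) s"
        "relabels (\<rho> k) (F ! (i - 1)) s (sts ! i)"
      using assms(1) unfolding derivation_def by blast
    have "set (take i sts) \<subseteq> state_of ` {\<tau>. itd k \<tau>}"
    proof
      fix t assume "t \<in> set (take i sts)"
      then obtain j where "j < i" "sts ! j = t"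
        using in_set_take_iff[of i sts] less.prems by auto
      then show "t \<in> state_of ` {\<tau>. itd k \<tau>}" using less.IH[of j] less.prems by simp
    qed
    then obtain \<sigma> where \<sigma>: "itd k \<sigma>" "s = state_of \<sigma>" using transition_state_of s(1) by blast
    have "F ! (i - 1) \<in> set F" using i by (intro nth_mem) auto
    then have "F ! (i - 1) \<in> relabelings k" using assms(1) by (auto simp: derivation_def)
    then obtain p where "p permutes labels k" "sts ! i = state_of (relabel_term p \<sigma>)"
      using relabels_state_of_iff[OF \<sigma>(1)] s(2) \<sigma>(2) by blast
    then show ?thesis using itd_relabel_term \<sigma>(1) by blast
  qed
qed

section \<open>Canonical terms\<close>

context
  fixes r :: "witness rel"
  assumes lin: "linear_order_on (wit C) r"
begin

text \<open>Minimality is asked of the state, so terms need no order of their own; equality is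
  allowed because a nontrivial permutation may leave the state unchanged.\<close>

definition least_term :: "iterm \<Rightarrow> bool" where
  "least_term \<tau> \<longleftrightarrow> itd k \<tau> \<and> (\<forall>p. p permutes labels k \<longrightarrow>
     state_of (relabel_term p \<tau>) = state_of \<tau> \<or>
     (state_of \<tau>, state_of (relabel_term p \<tau>)) \<in> state_less r)"

lemma canonical_if_least_term:
  assumes "least_term \<tau>"
  shows "canonical k (\<rho> k) r (state_of \<tau>)"
proof -
  have \<tau>: "itd k \<tau>" using assms by (simp add: least_term_def)
  let ?X = "{s. \<exists>f\<in>relabelings k. relabels (\<rho> k) f (state_of \<tau>) s}"
  have X: "?X = {s. \<exists>p. p permutes labels k \<and> s = state_of (relabel_term p \<tau>)}"
    using relabels_state_of_iff[OF \<tau>] by blast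
  have "state_of \<tau> \<in> ?X"
    unfolding X by (intro CollectI exI[of _ id]) (simp add: permutes_id relabel_term_id)
  moreover have least: "\<forall>s\<in>?X. s = state_of \<tau> \<or> (state_of \<tau>, s) \<in> state_less r"
    unfolding X using assms unfolding least_term_def by blast
  ultimately have "(THE s. s \<in> ?X \<and> (\<forall>s'\<in>?X. s' = s \<or> (s, s') \<in> state_less r)) = state_of \<tau>"
  proof (intro the_equality conjI)
    fix s assume s: "s \<in> ?X \<and> (\<forall>s'\<in>?X. s' = s \<or> (s, s') \<in> state_less r)"
    show "s = state_of \<tau>"
    proof (rule ccontr)
      assume "s \<noteq> state_of \<tau>"
      then have "(state_of \<tau>, s) \<in> state_less r" using least s by blast
      moreover have "(s, state_of \<tau>) \<in> state_less r"
        using s \<open>state_of \<tau> \<in> ?X\<close> \<open>s \<noteq> state_of \<tau>\<close> by fastforce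
      ultimately show False using asymD[OF state_less_asym[OF lin]] by blast
    qed
  qed
  then show ?thesis unfolding canonical_def CAN_def Let_def .
qed

text \<open>There are finitely many permutations, so the totally ordered set of states has a least
  element. Permuting the chosen term again stays within this set, because permutations
  compose.\<close>

lemma ex_least_term:
  assumes "itd k \<tau>"
  obtains p where "p permutes labels k" "least_term (relabel_term p \<tau>)"
proof -
  let ?X = "(\<lambda>p. state_of (relabel_term p \<tau>)) ` {p. p permutes labels k}"
  have "?X \<subseteq> {(b, S). finite b \<and> finite S \<and> S \<subseteq> wit C}"
    using state_of_well_formed[OF itd_relabel_term[OF _ assms]] finite_subset[of _ "labels k"]
    by (force simp: is_state_def fin_subset_def state_of_def)
  then have tot: "total_on ?X (state_less r)"
    using state_less_total[OF lin] by (meson total_on_subset)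
  have fin: "finite ?X" using finite_permutations[of "labels k"] by simp
  have ne: "?X \<noteq> {}" using permutes_id by blast
  have "\<exists>l\<in>?X. \<forall>s\<in>?X. s \<noteq> l \<longrightarrow> (l, s) \<in> state_less r"
  proof (rule Finite_Set.bex_least_element[OF fin ne])
    show "transp_on ?X (\<lambda>s t. (s, t) \<in> state_less r)"
      using transD[OF state_less_trans[OF lin]] by (intro transp_onI)
    show "totalp_on ?X (\<lambda>s t. (s, t) \<in> state_less r)"
      using tot by (simp add: totalp_on_def total_on_def)
  qed
  then obtain l where l: "l \<in> ?X" "\<forall>s\<in>?X. s \<noteq> l \<longrightarrow> (l, s) \<in> state_less r" by (elim bexE)
  from l(1) obtain p where p: "p permutes labels k" and "l = state_of (relabel_term p \<tau>)" by blast
  then have min: "\<forall>s\<in>?X. s \<noteq> state_of (relabel_term p \<tau>) \<longrightarrow>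
      (state_of (relabel_term p \<tau>), s) \<in> state_less r" using l(2) by simp
  have "state_of (relabel_term q (relabel_term p \<tau>)) \<in> ?X" if "q permutes labels k" for q
    unfolding relabel_term_comp using permutes_compose[OF p that] by blast
  then have "least_term (relabel_term p \<tau>)"
    unfolding least_term_def using min itd_relabel_term[OF p assms] by blast
  then show thesis using that p by blast
qed

text \<open>A refutation starts with the initial state itself, to which no relabeling is applied, so
  this state has to be canonical from the outset.\<close>

lemma least_term_Leaf: "least_term Leaf"
  by (simp add: least_term_def)

text \<open>The order on states compares bags first, so the bag of a least term depends only on its size.\<close>

lemma least_term_bag_eq:
  assumes "least_term \<sigma>" "least_term \<tau>" and q: "q permutes labels k" "bag \<tau> = q ` bag \<sigma>"
  shows "bag \<sigma> = bag \<tau>"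
proof (rule ccontr)
  \<comment> \<open>If \<open>p\<close> changes the bag of a least term, the first component of the
    lexicographic product decides the comparison, and the new bag is strictly larger.\<close>
  have less: "(sorted_list_of_set (bag \<upsilon>), sorted_list_of_set (p ` bag \<upsilon>)) \<in> lexord less_than"
    if "least_term \<upsilon>" "p permutes labels k" "bag \<upsilon> \<noteq> p ` bag \<upsilon>" for p \<upsilon>
  proof -
    have bag: "bag (relabel_term p \<upsilon>) = p ` bag \<upsilon>"
      using bag_relabel_term[OF permutes_inj[OF that(2)]] .
    have "finite (bag \<upsilon>)"
      using that(1) bag_subset_labels by (auto simp: least_term_def intro: finite_subset)
    then have "sorted_list_of_set (bag \<upsilon>) \<noteq> sorted_list_of_set (p ` bag \<upsilon>)"
      using that(3) by (metis finite_imageI sorted_list_of_set.set_sorted_key_list_of_set)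
    moreover have "(state_of \<upsilon>, state_of (relabel_term p \<upsilon>)) \<in> state_less r"
    proof -
      have "state_of (relabel_term p \<upsilon>) \<noteq> state_of \<upsilon>"
        using that(3) bag by (auto simp: state_of_def)
      then show ?thesis using that(1,2) unfolding least_term_def by blast
    qed
    ultimately show ?thesis using bag by (simp add: state_less_def state_of_def)
  qed
  assume neq: "bag \<sigma> \<noteq> bag \<tau>"
  \<comment> \<open>Using \<open>q\<close> in one direction and its inverse in the other would make
    each bag strictly smaller than the other.\<close>
  have inv: "inv q ` bag \<tau> = bag \<sigma>"
    using q by (simp add: image_comp permutes_inv_o)
  have "(sorted_list_of_set (bag \<sigma>), sorted_list_of_set (bag \<tau>)) \<in> lexord less_than"
    using less[OF assms(1) q(1)] neq q(2) by simp
  moreover have "(sorted_list_of_set (bag \<tau>), sorted_list_of_set (bag \<sigma>)) \<in> lexord less_than"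
    using less[OF assms(2) permutes_inv[OF q(1)]] neq inv by simp
  ultimately show False
    using asymD[OF lexord_asym[OF asym_less_than]] by blast
qed

text \<open>Tracking least terms instead of canonical states yields canonicity and well-formedness
  of every state at once.\<close>

definition least_derivation :: "(nat \<rightharpoonup> nat) list \<Rightarrow> state list \<Rightarrow> bool" where
  "least_derivation F sts \<longleftrightarrow> derivation k C (\<rho> k) F sts \<and> set sts \<subseteq> state_of ` Collect least_term"

text \<open>Here the entries of the relabeling sequence arise: the appended one is the minimizing
  permutation \<open>p\<close> restricted to the bag that the transition produced.\<close>

lemma least_derivation_extend:
  assumes d: "least_derivation F sts" and "itd k \<tau>" "transition k C (\<rho> k) (set sts) (state_of \<tau>)"
  obtains F' sts' p where "least_derivation F' sts'" "set sts \<subseteq> set sts'" "p permutes labels k"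
    "least_term (relabel_term p \<tau>)" "state_of (relabel_term p \<tau>) \<in> set sts'"
proof -
  obtain p where p: "p permutes labels k" "least_term (relabel_term p \<tau>)"
    using ex_least_term[OF assms(2)] .
  let ?f = "map_on p (bag \<tau>)" and ?s = "state_of (relabel_term p \<tau>)"
  have "derivation k C (\<rho> k) (F @ [?f]) (sts @ [?s])"
    using derivation_snoc[OF _ assms(3)] d relabels_state_of[OF p(1) assms(2)]
      map_on_relabelings[OF p(1) bag_subset_labels[OF assms(2)]]
    by (auto simp: least_derivation_def)
  then have "least_derivation (F @ [?f]) (sts @ [?s])"
    using d p by (auto simp: least_derivation_def)
  then show thesis using that p by force
qed

text \<open>Derivations are extended rather than concatenated, so that a join can refer to the least terms
  of both children in one and the same derivation.\<close>

lemma least_derivation_reaches: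
  assumes "itd k \<tau>" "least_derivation F sts"
  obtains F' sts' p where "least_derivation F' sts'" "set sts \<subseteq> set sts'" "p permutes labels k"
    "least_term (relabel_term p \<tau>)" "state_of (relabel_term p \<tau>) \<in> set sts'"
proof -
  \<comment> \<open>The children are available only under some permutation \<open>q\<close>, so the
    instruction is applied to their permuted versions. Minimizing the result by a further
    permutation leads to a composite relabeling of \<open>\<tau>\<close>.\<close>
  have step: "\<exists>F' sts' p. least_derivation F' sts' \<and> set sts \<subseteq> set sts' \<and> p permutes labels k \<and>
      least_term (relabel_term p \<tau>) \<and> state_of (relabel_term p \<tau>) \<in> set sts'"
    if *: "least_derivation F\<^sub>1 sts\<^sub>1" "set sts \<subseteq> set sts\<^sub>1" "q permutes labels k" "itd k \<tau>"
      "transition k C (\<rho> k) (set sts\<^sub>1) (state_of (relabel_term q \<tau>))" for F\<^sub>1 sts sts\<^sub>1 q \<tau>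
  proof -
    obtain F' sts' p where "least_derivation F' sts'" "set sts\<^sub>1 \<subseteq> set sts'" "p permutes labels k"
      "least_term (relabel_term p (relabel_term q \<tau>))"
      "state_of (relabel_term p (relabel_term q \<tau>)) \<in> set sts'"
      using least_derivation_extend[OF *(1) itd_relabel_term[OF *(3,4)] *(5)] .
    then show ?thesis
      using *(2) permutes_compose[OF *(3)] unfolding relabel_term_comp by blast
  qed
  have "\<exists>F' sts' p. least_derivation F' sts' \<and> set sts \<subseteq> set sts' \<and> p permutes labels k \<and>
      least_term (relabel_term p \<tau>) \<and> state_of (relabel_term p \<tau>) \<in> set sts'"
    using assms
  proof (induction \<tau> arbitrary: F sts)
    case Leaf
    have "sts ! 0 = state_of Leaf" "0 < length sts"
      using Leaf(2) by (auto simp: least_derivation_def derivation_def state_of_def initial_state_def)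
    then have "state_of Leaf \<in> set sts" using nth_mem by metis
    then show ?case using Leaf(2) least_term_Leaf permutes_id[of "labels k"]
      by (metis relabel_term_id order_refl)
  next
    case (IntroVertex u \<sigma>)
    then obtain F\<^sub>1 sts\<^sub>1 q where 1: "least_derivation F\<^sub>1 sts\<^sub>1" "set sts \<subseteq> set sts\<^sub>1"
      "q permutes labels k" "state_of (relabel_term q \<sigma>) \<in> set sts\<^sub>1"
      by (meson itd.simps(2))
    have q: "itd k (IntroVertex (q u) (relabel_term q \<sigma>))"
      using itd_relabel_term[OF 1(3) IntroVertex.prems(1)] by simp
    have "transition k C (\<rho> k) (set sts\<^sub>1) (state_of (relabel_term q (IntroVertex u \<sigma>)))"
      using transition.intro_vertex[OF 1(4)[unfolded state_of_def], of "q u" k C "\<rho> k"] q dyn_simps(1)[OF q]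
      by (simp add: state_of_def)
    then show ?case using step[OF 1(1-3) IntroVertex.prems(1)] by blast
  next
    case (ForgetVertex u \<sigma>)
    then obtain F\<^sub>1 sts\<^sub>1 q where 1: "least_derivation F\<^sub>1 sts\<^sub>1" "set sts \<subseteq> set sts\<^sub>1"
      "q permutes labels k" "state_of (relabel_term q \<sigma>) \<in> set sts\<^sub>1"
      by (meson itd.simps(3))
    have q: "itd k (ForgetVertex (q u) (relabel_term q \<sigma>))"
      using itd_relabel_term[OF 1(3) ForgetVertex.prems(1)] by simp
    have "transition k C (\<rho> k) (set sts\<^sub>1) (state_of (relabel_term q (ForgetVertex u \<sigma>)))"
      using transition.forget_vertex[OF 1(4)[unfolded state_of_def], of "q u" k C "\<rho> k"] q dyn_simps(2)[OF q]
      by (simp add: state_of_def)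
    then show ?case using step[OF 1(1-3) ForgetVertex.prems(1)] by blast
  next
    case (IntroEdge u v \<sigma>)
    then obtain F\<^sub>1 sts\<^sub>1 q where 1: "least_derivation F\<^sub>1 sts\<^sub>1" "set sts \<subseteq> set sts\<^sub>1"
      "q permutes labels k" "state_of (relabel_term q \<sigma>) \<in> set sts\<^sub>1"
      by (meson itd.simps(4))
    have q: "itd k (IntroEdge (q u) (q v) (relabel_term q \<sigma>))"
      using itd_relabel_term[OF 1(3) IntroEdge.prems(1)] by simp
    have "transition k C (\<rho> k) (set sts\<^sub>1) (state_of (relabel_term q (IntroEdge u v \<sigma>)))"
      using transition.intro_edge[OF 1(4)[unfolded state_of_def], of "q u" "q v" k C "\<rho> k"] q
        dyn_simps(3)[OF q]
      by (simp add: state_of_def)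
    then show ?case using step[OF 1(1-3) IntroEdge.prems(1)] by blast
  next
    case (Join \<sigma>\<^sub>1 \<sigma>\<^sub>2)
    then have \<sigma>: "itd k \<sigma>\<^sub>1" "itd k \<sigma>\<^sub>2" "bag \<sigma>\<^sub>1 = bag \<sigma>\<^sub>2" by auto
    obtain F\<^sub>1 sts\<^sub>1 p where 1: "least_derivation F\<^sub>1 sts\<^sub>1" "set sts \<subseteq> set sts\<^sub>1" "p permutes labels k"
      "least_term (relabel_term p \<sigma>\<^sub>1)" "state_of (relabel_term p \<sigma>\<^sub>1) \<in> set sts\<^sub>1"
      using Join.IH(1)[OF \<sigma>(1) Join.prems(2)] by blast
    obtain F\<^sub>2 sts\<^sub>2 q where 2: "least_derivation F\<^sub>2 sts\<^sub>2" "set sts\<^sub>1 \<subseteq> set sts\<^sub>2" "q permutes labels k"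
      "least_term (relabel_term q \<sigma>\<^sub>2)" "state_of (relabel_term q \<sigma>\<^sub>2) \<in> set sts\<^sub>2"
      using Join.IH(2)[OF \<sigma>(2) 1(1)] by blast
    have bags: "bag (relabel_term p \<sigma>\<^sub>1) = p ` bag \<sigma>\<^sub>1" "bag (relabel_term q \<sigma>\<^sub>2) = q ` bag \<sigma>\<^sub>1"
      using bag_relabel_term[OF permutes_inj] 1(3) 2(3) \<sigma>(3) by auto
    \<comment> \<open>\<open>t\<close> undoes \<open>q\<close> and then applies \<open>p\<close>. It
      carries one least bag to the other, so the two bags coincide, and its restriction to the
      common bag is the permutation needed in the join rule.\<close>
    define t where "t = p \<circ> inv q"
    have t: "t permutes labels k" "t \<circ> q = p"
      using permutes_compose[OF permutes_inv[OF 2(3)] 1(3)] permutes_inv_o(2)[OF 2(3)]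
      by (simp_all add: t_def comp_assoc)
    have tq: "t ` q ` bag \<sigma>\<^sub>1 = p ` bag \<sigma>\<^sub>1" using t(2) by (simp add: image_comp)
    have eq: "q ` bag \<sigma>\<^sub>1 = p ` bag \<sigma>\<^sub>1"
      using least_term_bag_eq[OF 2(4) 1(4) t(1)] tq bags by simp
    have q\<sigma>: "itd k (relabel_term q \<sigma>\<^sub>2)" using itd_relabel_term[OF 2(3) \<sigma>(2)] .
    have rel: "relabels (\<rho> k) (map_on t (q ` bag \<sigma>\<^sub>1)) (state_of (relabel_term q \<sigma>\<^sub>2))
        (state_of (relabel_term p \<sigma>\<^sub>2))"
      using relabels_state_of[OF t(1) q\<sigma>] bags(2) t(2) by (simp add: relabel_term_comp)
    have itd: "itd k (Join (relabel_term p \<sigma>\<^sub>1) (relabel_term p \<sigma>\<^sub>2))"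
      using itd_relabel_term[OF 1(3) Join.prems(1)] by simp
    \<comment> \<open>After \<open>t\<close> has acted on the second state, both children appear
      under the same permutation \<open>p\<close>, so the result is the state of the whole join
      relabeled by \<open>p\<close>.\<close>
    have "transition k C (\<rho> k) (set sts\<^sub>2)
        (bag (relabel_term p \<sigma>\<^sub>1), join_set C (dyn C (relabel_term p \<sigma>\<^sub>1)) (dyn C (relabel_term p \<sigma>\<^sub>2)))"
    proof (rule transition.join)
      show "(bag (relabel_term p \<sigma>\<^sub>1), dyn C (relabel_term p \<sigma>\<^sub>1)) \<in> set sts\<^sub>2"
        using 1(5) 2(2) by (auto simp: state_of_def)
      show "(bag (relabel_term p \<sigma>\<^sub>1), dyn C (relabel_term q \<sigma>\<^sub>2)) \<in> set sts\<^sub>2"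
        using 2(5) bags eq by (simp add: state_of_def)
      show "map_on t (q ` bag \<sigma>\<^sub>1) \<in> relabelings k"
        using map_on_relabelings[OF t(1)] bag_subset_labels[OF q\<sigma>] bags by simp
      show "dom (map_on t (q ` bag \<sigma>\<^sub>1)) = bag (relabel_term p \<sigma>\<^sub>1)" using bags eq by simp
      show "ran (map_on t (q ` bag \<sigma>\<^sub>1)) = bag (relabel_term p \<sigma>\<^sub>1)"
        unfolding ran_map_on tq bags ..
      show "act_set (\<rho> k) (map_on t (q ` bag \<sigma>\<^sub>1)) (dyn C (relabel_term q \<sigma>\<^sub>2)) =
          Some (dyn C (relabel_term p \<sigma>\<^sub>2))"
        using rel unfolding relabels_def state_of_def by blast
    qed
    then have "transition k C (\<rho> k) (set sts\<^sub>2) (state_of (relabel_term p (Join \<sigma>\<^sub>1 \<sigma>\<^sub>2)))"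
      using dyn_simps(4)[OF itd] by (simp add: state_of_def)
    then show ?case using step[OF 2(1) _ 1(3) Join.prems(1)] 1(2) 2(2) by blast
  qed
  then show thesis using that by blast
qed

text \<open>The derivation that reaches the canonical version of the term is cut at that state. It
  is inconsistent because the action preserves finality of witnesses.\<close>

lemma canonized_refutation_if_not_accepts:
  assumes "itd k \<tau>" "\<not> accepts C \<tau>"
  shows "\<exists>sts. canonized_refutation k C L (\<rho> k) r sts"
proof -
  have "initial_state C = state_of Leaf" by (simp add: initial_state_def state_of_def)
  then have "least_derivation [] [initial_state C]"
    using least_term_Leaf by (auto simp: least_derivation_def derivation_def)
  then obtain F sts p where d: "least_derivation F sts" and "set [initial_state C] \<subseteq> set sts"
    and p: "p permutes labels k" and "least_term (relabel_term p \<tau>)"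
    and mem: "state_of (relabel_term p \<tau>) \<in> set sts"
    by (rule least_derivation_reaches[OF assms(1)])
  obtain n where n: "n < length sts" "sts ! n = state_of (relabel_term p \<tau>)"
    using mem by (auto simp: in_set_conv_nth)
  have len: "length sts = length F + 1" using d by (simp add: least_derivation_def derivation_def)
  have "derivation k C (\<rho> k) (take n F) (take (n + 1) sts)"
    using derivation_take[of k C "\<rho> k" F sts n] d n(1) len by (simp add: least_derivation_def)
  moreover have all: "\<exists>\<sigma>. s = state_of \<sigma> \<and> least_term \<sigma>" if "s \<in> set (take (n + 1) sts)" for s
    using that d by (auto simp: least_derivation_def dest!: in_set_takeD)
  moreover have "inconsistent C (take (n + 1) sts ! length (take n F))"
  proof -
    have "take (n + 1) sts ! length (take n F) = state_of (relabel_term p \<tau>)"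
      using n len by (simp add: min_absorb2)
    moreover have "\<not> final C (move p w)" if "w \<in> dyn C \<tau>" for w
      using that assms(2) move_wit(2)[OF p] fin_subset_dyn[OF assms(1)]
      by (auto simp: accepts_def fin_subset_def)
    ultimately show ?thesis
      using dyn_relabel_term[OF p assms(1)] by (auto simp: inconsistent_def state_of_def)
  qed
  ultimately have "relabeled_refutation k C L (\<rho> k) (take n F) (take (n + 1) sts)"
    using state_of_well_formed unfolding relabeled_refutation_iff_derivation least_term_def by blast
  moreover have "\<forall>s\<in>set (take (n + 1) sts). canonical k (\<rho> k) r s"
    using all canonical_if_least_term by blast
  ultimately show ?thesis unfolding canonized_refutation_def by blast
qed

end

lemma not_accepts_if_relabeled_refutation:
  assumes "relabeled_refutation k C L (\<rho> k) F sts"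
  obtains \<tau> where "itd k \<tau>" "\<not> accepts C \<tau>"
proof -
  have d: "derivation k C (\<rho> k) F sts" and inc: "inconsistent C (sts ! length F)"
    using assms unfolding relabeled_refutation_iff_derivation by auto
  then have "length F < length sts" by (simp add: derivation_def)
  then obtain \<tau> where "itd k \<tau>" "sts ! length F = state_of \<tau>"
    using derivation_state_of[OF d] by blast
  then show thesis using that inc by (auto simp: inconsistent_def accepts_def state_of_def)
qed

end

theorem theorem3:
  fixes D :: "nat \<Rightarrow> dp_tuple"
    and Lbl :: "nat \<Rightarrow> witness \<Rightarrow> nat set"
    and \<rho> :: "nat \<Rightarrow> action"
    and k :: nat
    and r :: "witness rel"
  assumes "dp_core D"
    and "label_assignment D Lbl"
    and "coherent D"
    and "interface_respecting D Lbl"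
    and "identity_cleaning D"
    and "\<And>k'. witness_action k' (D k') (Lbl k') (\<rho> k')"
    and "linear_order_on (wit (D k)) r"
  shows "(\<exists>sts. canonized_refutation k (D k) (Lbl k) (\<rho> k) r sts) \<longleftrightarrow>
         (\<exists>G. graph G \<and> treewidth_at_most k G \<and> G \<notin> core_property D)"
proof -
  interpret core_with_action D Lbl \<rho> k
    using assms by unfold_locales
  show ?thesis
  proof
    assume "\<exists>sts. canonized_refutation k (D k) (Lbl k) (\<rho> k) r sts"
    then obtain \<tau> where \<tau>: "itd k \<tau>" "\<not> accepts (D k) \<tau>"
      using not_accepts_if_relabeled_refutation unfolding canonized_refutation_def by blast
    \<comment> \<open>Membership would require an accepted term at some level with an isomorphic
      graph; coherence would then make \<open>\<tau>\<close> accepted.\<close>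
    have "graph_of \<tau> \<notin> core_property D"
      using assms(3) \<tau> unfolding coherent_def core_property_def level_property_def by blast
    moreover have "treewidth_at_most k (graph_of \<tau>)"
      using \<tau>(1) iso_refl unfolding treewidth_at_most_def by blast
    ultimately show "\<exists>G. graph G \<and> treewidth_at_most k G \<and> G \<notin> core_property D"
      using graph_graph_of[OF \<tau>(1)] by blast
  next
    assume "\<exists>G. graph G \<and> treewidth_at_most k G \<and> G \<notin> core_property D"
    then obtain G \<tau> where "graph G" "itd k \<tau>" "iso G (graph_of \<tau>)" "G \<notin> core_property D"
      unfolding treewidth_at_most_def by blast
    \<comment> \<open>Acceptance of \<open>\<tau>\<close> would put \<open>G\<close> into the
      property already at level \<open>k\<close>, since that property is closed under isomorphism of
      graphs.\<close>
    then have "itd k \<tau>" "\<not> accepts (D k) \<tau>"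
      unfolding core_property_def level_property_def by blast+
    then show "\<exists>sts. canonized_refutation k (D k) (Lbl k) (\<rho> k) r sts"
      using canonized_refutation_if_not_accepts[OF assms(7)] by blast
  qed
qed

end
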